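(* Consider any instance of the budgeted matching-market pricing problem (defined in the context) in which every buyer $i$ satisfies $b_i\ge v_i$. Then the revenue $\sum_i p_i$ of the outcome produced by Algorithm 1 (described in the context) is at least $\mathrm{OPT}/4$, where $\mathrm{OPT}$ is the optimal envy-free revenue, i.e. the maximum revenue of a feasible, individually rational, pairwise envy-free outcome.
   Context: Instance: a finite set $I$ of $n$ buyers and a finite set $J$ of $m$ distinct items. Each buyer $i$ has a preference set $S_i\subseteq J$, a value $v_i>0$ for each item of $S_i$ (value $0$ for items outside $S_i$), and a budget $b_i\ge 0$. An outcome $\langle\mathbf{X},\mathbf{p}\rangle$ consists of pairwise disjoint bundles $X_i\subseteq J$ and payments $p_i\ge 0$. The utility of buyer $i$ for bundle $X$ at payment $q$ is $u_i(X,q)=v_i|X\cap S_i|-q$ if $q\le b_i$ and $-\infty$ if $q>b_i$. The outcome is individually rational if $u_i(X_i,p_i)\ge 0$ for all $i$; its revenue is $\sum_i p_i$. It is pairwise envy-free if $u_i(X_i,p_i)\ge u_i(X_k,p_k)$ for all buyers $i,k$. Algorithm 1 (ascending price auction). Throughout, $b_i$ denotes buyer $i$'s remaining budget (initially her budget, decreased by each payment), $J$ denotes the set of currently unsold items, and $\epsilon>0$ is an arbitrarily small price increment. For a price $p>0$, the demand of buyer $i$ is $D_i(p)=\min\{\lfloor b_i/p\rfloor,|S_i|\}$ if $p\le v_i$ and $D_i(p)=0$ if $p>v_i$. Let $A^p=\{i: v_i>p, D_i(p)>0\}$, $Q^p=\{i: v_i=p, D_i(p)>0\}$, $I^p=A^p\cup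 Q^p$. $G^p$ is the bipartite graph on $I^p\cup J$ with an edge $(i,j)$ iff $j\in S_i$, and $\bar G^p$ is its subgraph on $A^p\cup J$. A $B$-matching of $G^p$ (or $\bar G^p$) is a set of its edges in which every buyer $i$ lies in at most $D_i(p)$ edges and every item in at most one edge; $\mathcal{M}(G^p)$ denotes a maximum one. Given a $B$-matching $\mathcal{M}$, an augmenting path from buyer $i$ to item $j$ is a sequence $i=y_1,z_1,y_2,z_2,\dots,y_h,z_h=j$ of buyers $y_k$ and items $z_k$ with $z_k\in S_{y_k}$, $(y_k,z_k)\notin\mathcal{M}$ for all $k$, and $(z_k,y_{k+1})\in\mathcal{M}$ for $k<h$. "Giving item $j$ to buyer $i$ at price $q$" means: remove $j$ from $J$, add $j$ to $X_i$, increase $p_i$ by $q$ and decrease $b_i$ by $q$. Start with $p=0$, $X_i=\emptyset$, $p_i=0$. While a maximum $B$-matching of $G^p$ is nonempty: increase $p$ until $|\mathcal{M}(G^p)|>|\mathcal{M}(G^{p+\epsilon})|$ (a critical price). If $|\mathcal{M}(G^p)|>|\mathcal{M}(\bar G^p)|$, run Procedure I: let $J_Q=\bigcup_{i\in Q^p}S_i$; compute a maximum $B$-matching $\mathcal{M}$ of $\bar G^p$ that matches the minimum number of items of $J_Q$; let $\bar J$ be the items of $J$ unmatched in $\mathcal{M}$ and $N(\bar J)$ the buyers having an augmenting path w.r.t. $\mathcal{M}$ to some item of $\bar J$; give each item $j$ with $(i,j)\in\mathcal{M}$, $i\in N(\bar J)$, to $i$ at price $p$; and assign the items of $\bar J$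 to buyers in $Q^p$ (respecting supply and budget constraints), each at price $p$. Otherwise run Procedure II: compute a maximum $B$-matching $\mathcal{M}$ of $G^{p+\epsilon}$; let $\bar J$ be the items unmatched in it and $N(\bar J)$ the buyers having an augmenting path to an item of $\bar J$; give each item $j$ with $(i,j)\in\mathcal{M}$, $i\in N(\bar J)$, to $i$ at price $p+\epsilon$; remove $\bar J$ from $J$; and remove all items no longer demanded by any buyer. *)

theory Defs
  imports Main "HOL-Library.Extended_Real"
begin

text \<open>Buyers have type 'b, items type 'i. An instance is given by a finite buyer set I,
 a finite item set J, preference sets S, values v and budgets b.\<close>

definition util :: "('b \<Rightarrow> 'i set) \<Rightarrow> ('b \<Rightarrow> real) \<Rightarrow> ('b \<Rightarrow> real) \<Rightarrow> 'b \<Rightarrow> 'i set \<Rightarrow> real \<Rightarrow> ereal" where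
  "util S v b i Y q = (if q \<le> b i then ereal (v i * real (card (Y \<inter> S i)) - q) else -\<infinity>)"

definition ef_outcome ::
  "'b set \<Rightarrow> 'i set \<Rightarrow> ('b \<Rightarrow> 'i set) \<Rightarrow> ('b \<Rightarrow> real) \<Rightarrow> ('b \<Rightarrow> real) \<Rightarrow> ('b \<Rightarrow> 'i set) \<Rightarrow> ('b \<Rightarrow> real) \<Rightarrow> bool" where
  "ef_outcome I J S v b X P \<longleftrightarrow>
     (\<forall>i\<in>I. X i \<subseteq> J) \<and>
     (\<forall>i\<in>I. \<forall>k\<in>I. i \<noteq> k \<longrightarrow> X i \<inter> X k = {}) \<and>
     (\<forall>i\<in>I. 0 \<le> P i) \<and>
     (\<forall>i\<in>I. 0 \<le> util S v b i (X i) (P i)) \<and>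
     (\<forall>i\<in>I. \<forall>k\<in>I. util S v b i (X k) (P k) \<le> util S v b i (X i) (P i))"

text \<open>OPT: the optimal (supremum = maximum) revenue of a feasible, individually rational,
 pairwise envy-free outcome.\<close>
definition opt_rev :: "'b set \<Rightarrow> 'i set \<Rightarrow> ('b \<Rightarrow> 'i set) \<Rightarrow> ('b \<Rightarrow> real) \<Rightarrow> ('b \<Rightarrow> real) \<Rightarrow> real" where
  "opt_rev I J S v b = Sup {(\<Sum>i\<in>I. P i) | X P. ef_outcome I J S v b X P}"

section \<open>Algorithm 1 (idealised: epsilon infinitesimal)\<close>

definition dem :: "('b \<Rightarrow> real) \<Rightarrow> ('b \<Rightarrow> 'i set) \<Rightarrow> ('b \<Rightarrow> real) \<Rightarrow> real \<Rightarrow> 'b \<Rightarrow> nat" where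
  "dem v S rb p i = (if 0 < p \<and> p \<le> v i then min (nat \<lfloor>rb i / p\<rfloor>) (card (S i)) else 0)"

text \<open>Demand D_i(p+\<epsilon>) for all sufficiently small \<epsilon> > 0 (right limit at p):
  floor(rb/(p+\<epsilon>)) = ceiling(rb/p) - 1 for small \<epsilon>, and p + \<epsilon> \<le> v_i iff p < v_i.\<close>
definition rdem :: "('b \<Rightarrow> real) \<Rightarrow> ('b \<Rightarrow> 'i set) \<Rightarrow> ('b \<Rightarrow> real) \<Rightarrow> real \<Rightarrow> 'b \<Rightarrow> nat" where
  "rdem v S rb p i = (if 0 < p \<and> p < v i then min (nat (\<lceil>rb i / p\<rceil> - 1)) (card (S i)) else 0)"

definition edges :: "('b \<Rightarrow> 'i set) \<Rightarrow> 'b set \<Rightarrow> 'i set \<Rightarrow> ('b \<times> 'i) set" where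
  "edges S B Jr = {(i, j). i \<in> B \<and> j \<in> Jr \<and> j \<in> S i}"

definition bmatching :: "('b \<Rightarrow> 'i set) \<Rightarrow> 'b set \<Rightarrow> ('b \<Rightarrow> nat) \<Rightarrow> 'i set \<Rightarrow> ('b \<times> 'i) set \<Rightarrow> bool" where
  "bmatching S B c Jr M \<longleftrightarrow> M \<subseteq> edges S B Jr \<and>
     (\<forall>i. card {j. (i, j) \<in> M} \<le> c i) \<and> (\<forall>j. card {i. (i, j) \<in> M} \<le> 1)"

definition max_bmatching :: "('b \<Rightarrow> 'i set) \<Rightarrow> 'b set \<Rightarrow> ('b \<Rightarrow> nat) \<Rightarrow> 'i set \<Rightarrow> ('b \<times> 'i) set \<Rightarrow> bool" where
  "max_bmatching S B c Jr M \<longleftrightarrow> bmatching S B c Jr M \<and>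
     (\<forall>M'. bmatching S B c Jr M' \<longrightarrow> card M' \<le> card M)"

definition bsize :: "('b \<Rightarrow> 'i set) \<Rightarrow> 'b set \<Rightarrow> ('b \<Rightarrow> nat) \<Rightarrow> 'i set \<Rightarrow> nat" where
  "bsize S B c Jr = Max (card ` {M. bmatching S B c Jr M})"

definition Abuyers :: "'b set \<Rightarrow> ('b \<Rightarrow> 'i set) \<Rightarrow> ('b \<Rightarrow> real) \<Rightarrow> ('b \<Rightarrow> real) \<Rightarrow> real \<Rightarrow> 'b set" where
  "Abuyers I S v rb p = {i \<in> I. p < v i \<and> 0 < dem v S rb p i}"

definition Qbuyers :: "'b set \<Rightarrow> ('b \<Rightarrow> 'i set) \<Rightarrow> ('b \<Rightarrow> real) \<Rightarrow> ('b \<Rightarrow> real) \<Rightarrow> real \<Rightarrow> 'b set" where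
  "Qbuyers I S v rb p = {i \<in> I. v i = p \<and> 0 < dem v S rb p i}"

definition Pbuyers :: "'b set \<Rightarrow> ('b \<Rightarrow> 'i set) \<Rightarrow> ('b \<Rightarrow> real) \<Rightarrow> ('b \<Rightarrow> real) \<Rightarrow> real \<Rightarrow> 'b set" where
  "Pbuyers I S v rb p = {i \<in> I. p < v i \<and> 0 < rdem v S rb p i}"

definition sizeG :: "'b set \<Rightarrow> ('b \<Rightarrow> 'i set) \<Rightarrow> ('b \<Rightarrow> real) \<Rightarrow> 'i set \<Rightarrow> ('b \<Rightarrow> real) \<Rightarrow> real \<Rightarrow> nat" where
  "sizeG I S v Jr rb p = bsize S (Abuyers I S v rb p \<union> Qbuyers I S v rb p) (dem v S rb p) Jr"

definition sizeGbar :: "'b set \<Rightarrow> ('b \<Rightarrow> 'i set) \<Rightarrow> ('b \<Rightarrow> real) \<Rightarrow> 'i set \<Rightarrow> ('b \<Rightarrow> real) \<Rightarrow> real \<Rightarrow> nat" where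
  "sizeGbar I S v Jr rb p = bsize S (Abuyers I S v rb p) (dem v S rb p) Jr"

definition sizeGplus :: "'b set \<Rightarrow> ('b \<Rightarrow> 'i set) \<Rightarrow> ('b \<Rightarrow> real) \<Rightarrow> 'i set \<Rightarrow> ('b \<Rightarrow> real) \<Rightarrow> real \<Rightarrow> nat" where
  "sizeGplus I S v Jr rb p = bsize S (Pbuyers I S v rb p) (rdem v S rb p) Jr"

definition critical :: "'b set \<Rightarrow> ('b \<Rightarrow> 'i set) \<Rightarrow> ('b \<Rightarrow> real) \<Rightarrow> 'i set \<Rightarrow> ('b \<Rightarrow> real) \<Rightarrow> real \<Rightarrow> bool" where
  "critical I S v Jr rb q \<longleftrightarrow> 0 < q \<and> sizeGplus I S v Jr rb q < sizeG I S v Jr rb q"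

text \<open>Augmenting (alternating) path w.r.t. M from buyer i to item j:
 i = y_1, z_1, ..., y_h, z_h = j with z_k \<in> S y_k, (y_k,z_k) \<notin> M, (y_{k+1}, z_k) \<in> M.\<close>
inductive altp :: "('b \<Rightarrow> 'i set) \<Rightarrow> 'b set \<Rightarrow> 'i set \<Rightarrow> ('b \<times> 'i) set \<Rightarrow> 'b \<Rightarrow> 'i \<Rightarrow> bool"
  for S B Jr M where
  base: "\<lbrakk>i \<in> B; j \<in> Jr; j \<in> S i; (i, j) \<notin> M\<rbrakk> \<Longrightarrow> altp S B Jr M i j"
| step: "\<lbrakk>i \<in> B; z \<in> Jr; z \<in> S i; (i, z) \<notin> M; (y, z) \<in> M; altp S B Jr M y j\<rbrakk> \<Longrightarrow> altp S B Jr M i j"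

definition nbrs :: "('b \<Rightarrow> 'i set) \<Rightarrow> 'b set \<Rightarrow> 'i set \<Rightarrow> ('b \<times> 'i) set \<Rightarrow> 'i set \<Rightarrow> 'b set" where
  "nbrs S B Jr M Jbar = {i \<in> B. \<exists>j\<in>Jbar. altp S B Jr M i j}"

text \<open>State: (current price p, unsold items J, bundles X, payments, remaining budgets).\<close>
type_synonym ('b, 'i) st = "real \<times> 'i set \<times> ('b \<Rightarrow> 'i set) \<times> ('b \<Rightarrow> real) \<times> ('b \<Rightarrow> real)"

inductive alg_step :: "'b set \<Rightarrow> ('b \<Rightarrow> 'i set) \<Rightarrow> ('b \<Rightarrow> real) \<Rightarrow> ('b, 'i) st \<Rightarrow> ('b, 'i) st \<Rightarrow> bool"
  for I S v where
  procI: "\<lbrakk> critical I S v Jr rb q; p0 \<le> q;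
            \<forall>q'. p0 \<le> q' \<and> q' < q \<longrightarrow> \<not> critical I S v Jr rb q';
            sizeGbar I S v Jr rb q < sizeG I S v Jr rb q;
            A = Abuyers I S v rb q; Qb = Qbuyers I S v rb q;
            JQ = \<Union> (S ` Qb);
            max_bmatching S A (dem v S rb q) Jr M;
            \<forall>M'. max_bmatching S A (dem v S rb q) Jr M' \<longrightarrow> card (snd ` M \<inter> JQ) \<le> card (snd ` M' \<inter> JQ);
            Jbar = Jr - snd ` M;
            N = nbrs S A Jr M Jbar;
            max_bmatching S Qb (dem v S rb q) Jbar T;
            G = (\<lambda>i. {j. (i, j) \<in> M \<and> i \<in> N} \<union> {j. (i, j) \<in> T}) \<rbrakk>
          \<Longrightarrow> alg_step I S v (p0, Jr, X, pay, rb)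
                (q, Jr - \<Union> (G ` I), \<lambda>i. X i \<union> G i, \<lambda>i. pay i + q * real (card (G i)),
                 \<lambda>i. rb i - q * real (card (G i)))"
| procII: "\<lbrakk> critical I S v Jr rb q; p0 \<le> q;
            \<forall>q'. p0 \<le> q' \<and> q' < q \<longrightarrow> \<not> critical I S v Jr rb q';
            \<not> sizeGbar I S v Jr rb q < sizeG I S v Jr rb q;
            P = Pbuyers I S v rb q;
            max_bmatching S P (rdem v S rb q) Jr M;
            Jbar = Jr - snd ` M;
            N = nbrs S P Jr M Jbar;
            G = (\<lambda>i. {j. (i, j) \<in> M \<and> i \<in> N});
            rb' = (\<lambda>i. rb i - q * real (card (G i)));
            J1 = Jr - \<Union> (G ` I) - Jbar;
            J2 = {j \<in> J1. \<exists>i\<in>I. j \<in> S i \<and> q < v i \<and> 0 < rdem v S rb' q i} \<rbrakk>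
          \<Longrightarrow> alg_step I S v (p0, Jr, X, pay, rb)
                (q, J2, \<lambda>i. X i \<union> G i, \<lambda>i. pay i + q * real (card (G i)), rb')"

definition alg_init :: "'i set \<Rightarrow> ('b \<Rightarrow> real) \<Rightarrow> ('b, 'i) st" where
  "alg_init J b = (0, J, \<lambda>_. {}, \<lambda>_. 0, b)"

text \<open>The while-loop stops when no critical price \<ge> the current price exists
 (equivalently, the maximum B-matching of G^p is empty).\<close>
definition alg_terminal :: "'b set \<Rightarrow> ('b \<Rightarrow> 'i set) \<Rightarrow> ('b \<Rightarrow> real) \<Rightarrow> ('b, 'i) st \<Rightarrow> bool" where
  "alg_terminal I S v s = (case s of (p, Jr, X, pay, rb) \<Rightarrow> \<not> (\<exists>q. p \<le> q \<and> critical I S v Jr rb q))"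

end

theory Submission
  imports Defs
begin

text \<open>Closedness under alternating paths makes every active buyer who wants a removed item
 saturated at the moment of removal. A saturated buyer has spent at least half of her budget: she
 buys at least one unit and keeps at most the price of one. Hence every buyer either pays half of
 her budget or sees no item of her set leave the market below her value. Items that leave unsold
 are paid for by those sold at the same stage: in Procedure I comparison with a matching of
 all demanded items bounds their number by the sales to saturated buyers, and in Procedure II
 the demand of each saturated buyer drops by at most one and stays positive. So the prices at which items leave sum to at most twice the revenue, and
 a benchmark revenue is at most the budgets of the first kind of buyers plus these prices.\<close>

section \<open>Maximum B-matchings\<close>

lemma bmatching_finite:
  "bmatching S B c Jr M \<Longrightarrow> finite B \<Longrightarrow> finite Jr \<Longrightarrow> finite M"
  by (rule finite_subset[of _ "B \<times> Jr"]) (auto simp: bmatching_def edges_def)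

lemma bmatching_edge:
  "bmatching S B c Jr M \<Longrightarrow> (i, j) \<in> M \<Longrightarrow> i \<in> B \<and> j \<in> Jr \<and> j \<in> S i"
  by (auto simp: bmatching_def edges_def)

lemma bmatching_unique:
  assumes "bmatching S B c Jr M" "finite B" "(i, j) \<in> M" "(k, j) \<in> M"
  shows "i = k"
proof -
  have "finite {i. (i, j) \<in> M}"
    by (rule finite_subset[OF _ assms(2)]) (use assms(1) in \<open>auto simp: bmatching_def edges_def\<close>)
  moreover have "card {i. (i, j) \<in> M} \<le> Suc 0"
    using assms(1) by (auto simp: bmatching_def)
  ultimately show ?thesis
    using assms(3,4) by (auto simp: card_le_Suc0_iff_eq)
qed

lemma bmatchingI:
  assumes "\<And>i j. (i, j) \<in> M \<Longrightarrow> i \<in> B \<and> j \<in> Jr \<and> j \<in> S i"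
    and "\<And>i. i \<in> B \<Longrightarrow> card {j. (i, j) \<in> M} \<le> c i"
    and "\<And>i k j. (i, j) \<in> M \<Longrightarrow> (k, j) \<in> M \<Longrightarrow> i = k"
  shows "bmatching S B c Jr M"
proof -
  have "card {j. (i, j) \<in> M} \<le> c i" for i
  proof (cases "i \<in> B")
    case False
    then have "{j. (i, j) \<in> M} = {}" using assms(1) by blast
    then show ?thesis by simp
  qed (rule assms(2))
  moreover have "card {i. (i, j) \<in> M} \<le> 1" for j
  proof (cases "\<exists>i. (i, j) \<in> M")
    case True
    then obtain i where "(i, j) \<in> M" ..
    then have "{i. (i, j) \<in> M} = {i}" using assms(3) by blast
    then show ?thesis by simp
  qed simp
  ultimately show ?thesis
    using assms(1) by (auto simp: bmatching_def edges_def)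
qed

lemma bmatching_degree: "bmatching S B c Jr M \<Longrightarrow> card {j. (i, j) \<in> M} \<le> c i"
  by (simp add: bmatching_def)

lemma bmatching_card_items:
  assumes "bmatching S B c Jr M" "finite B"
  shows "card (snd ` M) = card M"
  by (rule card_image) (auto simp: inj_on_def dest: bmatching_unique[OF assms])

lemma card_items_of_buyers:
  assumes "bmatching S B c Jr M" "finite B" "finite Jr" "finite N"
  shows "card {j. \<exists>i\<in>N. (i, j) \<in> M} = (\<Sum>i\<in>N. card {j. (i, j) \<in> M})"
proof -
  have fin: "finite {j. (i, j) \<in> M}" for i
    by (rule finite_subset[OF _ assms(3)]) (use bmatching_edge[OF assms(1)] in blast)
  have "{j. \<exists>i\<in>N. (i, j) \<in> M} = (\<Union>i\<in>N. {j. (i, j) \<in> M})" by blast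
  then show ?thesis
    by (simp only:, subst card_UN_disjoint)
      (use assms(4) fin bmatching_unique[OF assms(1,2)] in auto)
qed

section \<open>Alternating paths and saturated buyers\<close>

text \<open>A copy of \<open>altp\<close> that counts the matched edges of the path. The index
  permits induction on the length and the choice of a shortest path.\<close>

inductive altn :: "('b \<Rightarrow> 'i set) \<Rightarrow> 'b set \<Rightarrow> 'i set \<Rightarrow> ('b \<times> 'i) set \<Rightarrow> nat \<Rightarrow> 'b \<Rightarrow> 'i \<Rightarrow> bool"
  for S B Jr M where
  base: "\<lbrakk>i \<in> B; j \<in> Jr; j \<in> S i; (i, j) \<notin> M\<rbrakk> \<Longrightarrow> altn S B Jr M 0 i j"
| step: "\<lbrakk>i \<in> B; z \<in> Jr; z \<in> S i; (i, z) \<notin> M; (y, z) \<in> M; altn S B Jr M n y j\<rbrakk>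
          \<Longrightarrow> altn S B Jr M (Suc n) i j"

lemma altp_altn: "altp S B Jr M i j \<Longrightarrow> \<exists>n. altn S B Jr M n i j"
  by (induction rule: altp.induct) (blast intro: altn.intros)+

text \<open>A path that runs through \<open>z\<close> must continue from the partner of
  \<open>z\<close>, which is \<open>y0\<close>, and this tail is strictly shorter. A path whose
  tails are not of this kind never touches \<open>z\<close>.\<close>

lemma altn_avoid:
  assumes "altn S B Jr M n y j" "j \<noteq> z" "\<And>k. (k, z) \<in> M \<Longrightarrow> k = y0"
  shows "altn S B (Jr - {z}) M n y j \<or> (\<exists>m<n. altn S B Jr M m y0 j)"
  using assms
proof (induction rule: altn.induct)
  case (base i j)
  then show ?case by (auto intro: altn.base)
next
  case (step i w y n j)
  show ?case
  proof (cases "w = z")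
    case True
    then show ?thesis using step by blast
  next
    case False
    from step.IH[OF step.prems] show ?thesis
    proof
      assume "altn S B (Jr - {z}) M n y j"
      then show ?thesis using step.hyps False by (auto intro!: altn.step)
    qed (auto intro: less_SucI)
  qed
qed

text \<open>A path avoiding \<open>z\<close> inspects only edges at other items, where the two
  matchings agree.\<close>

lemma altn_transfer:
  assumes "altn S B (Jr - {z}) M n y j" "\<And>a w. w \<noteq> z \<Longrightarrow> (a, w) \<in> M \<longleftrightarrow> (a, w) \<in> M'"
  shows "altn S B Jr M' n y j"
  using assms(1)
proof (induction rule: altn.induct)
  case (base i j)
  then show ?case using assms(2) by (auto intro: altn.base)
next
  case (step i w y n j)
  then show ?case using assms(2) by (blast intro: altn.step)
qed

text \<open>Induction on the path length: shifting the first edge of the path to the unsaturated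
 buyer moves the deficiency to the next buyer, and a shortest path from there avoids the item
 whose partner changed.\<close>
lemma no_augmenting_path:
  assumes "finite B" "finite Jr"
  shows "max_bmatching S B c Jr M \<Longrightarrow> altn S B Jr M n i j \<Longrightarrow> j \<notin> snd ` M
    \<Longrightarrow> c i \<le> card {j. (i, j) \<in> M}"
proof (induction n arbitrary: M i rule: less_induct)
  case (less n)
  have bm: "bmatching S B c Jr M" and mx: "\<And>M'. bmatching S B c Jr M' \<Longrightarrow> card M' \<le> card M"
    using less.prems(1) by (auto simp: max_bmatching_def)
  have finM: "finite M" using bmatching_finite[OF bm assms] .
  have fin: "finite {j. (k, j) \<in> M}" for k
    by (rule finite_subset[OF _ assms(2)]) (use bmatching_edge[OF bm] in blast)
  note uniq = bmatching_unique[OF bm assms(1)]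
  show ?case
  proof (rule ccontr)
    assume "\<not> ?case"
    then have unsat: "Suc (card {j. (i, j) \<in> M}) \<le> c i" by simp
    from less.prems(2) show False
    proof cases
      case base
      \<comment> \<open>The target is free and \<open>i\<close> has spare capacity, so the edge
        itself enlarges the matching.\<close>
      let ?M = "insert (i, j) M"
      have "bmatching S B c Jr ?M"
      proof (rule bmatchingI)
        fix k assume "k \<in> B"
        have "{l. (i, l) \<in> ?M} = insert j {l. (i, l) \<in> M}" by auto
        moreover have "{l. (k, l) \<in> ?M} = {l. (k, l) \<in> M}" if "k \<noteq> i" using that by auto
        ultimately show "card {l. (k, l) \<in> ?M} \<le> c k"
          using unsat fin[of i] base bmatching_degree[OF bm, of k] by (cases "k = i") auto
      next
        fix a k l assume *: "(a, l) \<in> ?M" "(k, l) \<in> ?M"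
        have "(x, j) \<notin> M" for x using less.prems(3) by force
        with * show "a = k" using uniq[of a l k] by auto
      qed (use base bmatching_edge[OF bm] in auto)
      then have "card ?M \<le> card M" by (rule mx)
      then show False using finM base by simp
    next
      case (step z y m)
      \<comment> \<open>Handing \<open>z\<close> from \<open>y\<close> to \<open>i\<close> keeps the
        size, so the new matching is again maximum, but now \<open>y\<close> has spare
        capacity.\<close>
      let ?M = "insert (i, z) (M - {(y, z)})"
      have yi: "y \<noteq> i" using step by auto
      have bm': "bmatching S B c Jr ?M"
      proof (rule bmatchingI)
        fix k assume "k \<in> B"
        have "{l. (i, l) \<in> ?M} = insert z {l. (i, l) \<in> M}" using yi by auto
        moreover have "card {l. (k, l) \<in> ?M} \<le> card {l. (k, l) \<in> M}" if "k \<noteq> i"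
          by (rule card_mono[OF fin]) (use that in auto)
        ultimately show "card {l. (k, l) \<in> ?M} \<le> c k"
          using unsat fin[of i] step bmatching_degree[OF bm, of k] by (cases "k = i") fastforce+
      next
        fix a k l assume *: "(a, l) \<in> ?M" "(k, l) \<in> ?M"
        have "x = y" if "(x, z) \<in> M" for x using uniq[OF that] step by auto
        with * show "a = k" using uniq[of a l k] by auto
      qed (use step bmatching_edge[OF bm] in auto)
      have "card ?M = card M"
        using finM step yi card_Suc_Diff1[OF finM, of "(y, z)"] by simp
      then have mx': "max_bmatching S B c Jr ?M"
        using mx bm' by (simp add: max_bmatching_def)
      have "j \<noteq> z" using less.prems(3) step by force
      \<comment> \<open>Minimality excludes a shorter path from \<open>y\<close>, the second
        alternative of \<open>altn_avoid\<close>. The path chosen here therefore survives the change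
        at \<open>z\<close>.\<close>
      define n' where "n' = (LEAST n'. altn S B Jr M n' y j)"
      have n': "altn S B Jr M n' y j"
        unfolding n'_def by (rule LeastI) (rule step)
      have "n' \<le> m" unfolding n'_def by (rule Least_le) (rule step)
      have "\<not> (\<exists>m<n'. altn S B Jr M m y j)"
        unfolding n'_def using not_less_Least by blast
      then have "altn S B (Jr - {z}) M n' y j"
        using altn_avoid[OF n' \<open>j \<noteq> z\<close>, of y] uniq step by blast
      then have "altn S B Jr ?M n' y j"
        by (rule altn_transfer) auto
      moreover have "j \<notin> snd ` ?M" using less.prems(3) \<open>j \<noteq> z\<close> by auto
      moreover have "n' < n" using \<open>n' \<le> m\<close> step by simp
      ultimately have "c y \<le> card {j. (y, j) \<in> ?M}"
        by (intro less.IH[OF _ mx'])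
      also have "card {j. (y, j) \<in> ?M} < card {j. (y, j) \<in> M}"
        by (rule psubset_card_mono[OF fin]) (use yi step in auto)
      also have "\<dots> \<le> c y" by (rule bmatching_degree[OF bm])
      finally show False by simp
    qed
  qed
qed

lemma nbrs_saturated:
  assumes "finite B" "finite Jr" "max_bmatching S B c Jr M" "i \<in> nbrs S B Jr M (Jr - snd ` M)"
  shows "card {j. (i, j) \<in> M} = c i"
proof -
  obtain j where j: "j \<in> Jr - snd ` M" "altp S B Jr M i j"
    using assms(4) by (auto simp: nbrs_def)
  then obtain n where "altn S B Jr M n i j" by (auto dest: altp_altn)
  then have "c i \<le> card {j. (i, j) \<in> M}"
    using no_augmenting_path[OF assms(1-3)] j by blast
  then show ?thesis
    using assms(3) bmatching_degree[of S B c Jr M i] by (simp add: max_bmatching_def)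
qed

text \<open>The first edge of an alternating path is unmatched. Together with saturation this makes
  the capacity of the buyer smaller than \<open>card (S i)\<close>, so it is her budget, not her
  preference set, that limits her.\<close>

lemma nbrs_spare_item:
  assumes "i \<in> nbrs S B Jr M Jbar"
  shows "i \<in> B \<and> (\<exists>z\<in>S i. (i, z) \<notin> M)"
  using assms by (auto simp: nbrs_def elim: altp.cases)

lemma degree_less_card:
  assumes "bmatching S B c Jr M" "finite (S i)" "z \<in> S i" "(i, z) \<notin> M"
  shows "card {j. (i, j) \<in> M} < card (S i)"
  by (rule psubset_card_mono[OF assms(2)]) (use assms bmatching_edge[OF assms(1)] in blast)

text \<open>An unmatched edge to \<open>j\<close> either ends at a free item or prolongs the path of
  the partner of \<open>j\<close>; if the edge is matched, \<open>i\<close> is that partner.\<close>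

lemma nbrs_closed:
  assumes "bmatching S B c Jr M" "finite B" "i \<in> B" "j \<in> S i" "j \<in> Jr"
    and "j \<in> Jbar \<or> (k \<in> nbrs S B Jr M Jbar \<and> (k, j) \<in> M)" "Jbar = Jr - snd ` M"
  shows "i \<in> nbrs S B Jr M Jbar"
proof (cases "j \<in> Jbar")
  case True
  then have "(i, j) \<notin> M" using assms(7) by force
  then show ?thesis using assms True by (auto simp: nbrs_def intro: altp.base)
next
  case False
  then have k: "k \<in> nbrs S B Jr M Jbar" "(k, j) \<in> M" using assms(6) by auto
  show ?thesis
  proof (cases "(i, j) \<in> M")
    case True
    then show ?thesis using bmatching_unique[OF assms(1,2) True k(2)] k by simp
  next
    case False
    then show ?thesis using assms k by (auto simp: nbrs_def intro: altp.step)
  qed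
qed

section \<open>Matching sizes and changes of graph\<close>

lemma bmatching_le_bsize:
  assumes "finite B" "finite Jr" "bmatching S B c Jr M"
  shows "card M \<le> bsize S B c Jr"
proof -
  have "{M. bmatching S B c Jr M} \<subseteq> Pow (B \<times> Jr)"
    by (auto simp: bmatching_def edges_def)
  then have "finite {M. bmatching S B c Jr M}"
    by (rule finite_subset) (use assms in simp)
  then show ?thesis using assms(3) by (simp add: bsize_def)
qed

lemma bsize_attained:
  assumes "finite B" "finite Jr"
  obtains M where "bmatching S B c Jr M" "card M = bsize S B c Jr"
proof -
  have "{M. bmatching S B c Jr M} \<subseteq> Pow (B \<times> Jr)"
    by (auto simp: bmatching_def edges_def)
  then have "finite {M. bmatching S B c Jr M}"
    by (rule finite_subset) (use assms in simp)
  moreover have "bmatching S B c Jr {}" by (rule bmatchingI) auto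
  ultimately have "Max (card ` {M. bmatching S B c Jr M}) \<in> card ` {M. bmatching S B c Jr M}"
    by (intro Max_in) auto
  then show ?thesis using that by (auto simp: bsize_def)
qed

text \<open>The new capacities need to dominate only the old degrees of buyers that still occur.
  This covers restriction to some buyers or items as well as a change of price or budgets.\<close>

lemma bmatching_transfer:
  assumes "bmatching S B c Jr M" "finite B" "finite Jr" "M' \<subseteq> M"
    and "\<And>i j. (i, j) \<in> M' \<Longrightarrow> i \<in> B' \<and> j \<in> Jr'"
    and "\<And>i j. (i, j) \<in> M' \<Longrightarrow> card {j. (i, j) \<in> M} \<le> c' i"
  shows "bmatching S B' c' Jr' M'"
proof (rule bmatchingI)
  fix i assume "i \<in> B'"
  have fin: "finite {j. (i, j) \<in> M}"
    by (rule finite_subset[OF _ assms(3)]) (use bmatching_edge[OF assms(1)] in blast)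
  show "card {j. (i, j) \<in> M'} \<le> c' i"
  proof (cases "\<exists>j. (i, j) \<in> M'")
    case True
    then have "card {j. (i, j) \<in> M} \<le> c' i" using assms(6) by blast
    moreover have "card {j. (i, j) \<in> M'} \<le> card {j. (i, j) \<in> M}"
      by (rule card_mono[OF fin]) (use assms(4) in blast)
    ultimately show ?thesis by simp
  qed simp
next
  fix i k j assume "(i, j) \<in> M'" "(k, j) \<in> M'"
  then show "i = k" using bmatching_unique[OF assms(1,2), of i j k] assms(4) by blast
next
  fix i j assume "(i, j) \<in> M'"
  then show "i \<in> B' \<and> j \<in> Jr' \<and> j \<in> S i"
    using assms(4,5) bmatching_edge[OF assms(1)] by blast
qed

lemma bmatching_degree_pos:
  assumes "bmatching S B c Jr M" "finite Jr" "(i, j) \<in> M"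
  shows "0 < c i"
proof -
  have "finite {j. (i, j) \<in> M}"
    by (rule finite_subset[OF _ assms(2)]) (use bmatching_edge[OF assms(1)] in blast)
  then have "0 < card {j. (i, j) \<in> M}" using assms(3) by (auto simp: card_gt_0_iff)
  then show ?thesis using bmatching_degree[OF assms(1), of i] by simp
qed

section \<open>Demands as functions of the price\<close>

lemma rdem_le_dem: "rdem v S rb q i \<le> dem v S rb q i"
proof -
  have "\<lceil>rb i / q\<rceil> - 1 \<le> \<lfloor>rb i / q\<rfloor>" by linarith
  then show ?thesis by (auto simp: rdem_def dem_def min_le_iff_disj nat_mono)
qed

lemma dem_pos_antimono:
  assumes "dem v S rb q i = 0" "0 < q" "q \<le> x"
  shows "dem v S rb x i = 0"
proof (cases "x \<le> v i")
  case True
  have "nat \<lfloor>rb i / q\<rfloor> = 0 \<or> card (S i) = 0"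
    using assms True by (auto simp: dem_def min_def split: if_splits)
  then have "rb i / q < 1 \<or> card (S i) = 0" by linarith
  then have "rb i / x < 1 \<or> card (S i) = 0"
    using assms by (auto simp: divide_less_eq)
  then have "nat \<lfloor>rb i / x\<rfloor> = 0 \<or> card (S i) = 0"
    by (auto simp: floor_less_iff)
  then show ?thesis by (auto simp: dem_def)
qed (simp add: dem_def)

text \<open>The floor function is upper semicontinuous: close to \<open>q\<close> the quotient stays
  below the next integer. If \<open>v i < q\<close>, the demand already vanishes slightly below
  \<open>q\<close>.\<close>

lemma dem_left_cont:
  assumes "0 < q"
  shows "\<forall>\<^sub>F a in at_left q. dem v S rb a i \<le> dem v S rb q i"
proof (cases "q \<le> v i")
  case True
  have "((\<lambda>a. rb i / a) \<longlongrightarrow> rb i / q) (at_left q)"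
    using assms by (auto intro!: tendsto_eq_intros)
  then have "\<forall>\<^sub>F a in at_left q. rb i / a < of_int \<lfloor>rb i / q\<rfloor> + 1"
    by (rule order_tendstoD) linarith
  then show ?thesis
  proof eventually_elim
    case (elim a)
    then have "\<lfloor>rb i / a\<rfloor> \<le> \<lfloor>rb i / q\<rfloor>" by linarith
    then show ?case using True assms by (auto simp: dem_def min_le_iff_disj nat_mono)
  qed
next
  case False
  then have "\<forall>\<^sub>F a in at_left q. a \<in> {v i<..<q}"
    by (intro eventually_at_leftI[of "v i"]) auto
  then show ?thesis by eventually_elim (simp add: dem_def)
qed

text \<open>Slightly above \<open>q\<close> the quotient still exceeds
  \<open>\<lceil>rb i / q\<rceil> - 1\<close>, the largest integer strictly below
  \<open>rb i / q\<close>. Only this half of the right limit is used.\<close>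

lemma rdem_right_limit:
  assumes "0 < q"
  shows "\<forall>\<^sub>F a in at_right q. rdem v S rb q i \<le> dem v S rb a i"
proof (cases "q < v i")
  case True
  have "((\<lambda>a. rb i / a) \<longlongrightarrow> rb i / q) (at_right q)"
    using assms by (auto intro!: tendsto_eq_intros)
  then have "\<forall>\<^sub>F a in at_right q. rb i / a > of_int \<lceil>rb i / q\<rceil> - 1"
    by (rule order_tendstoD) linarith
  moreover have "\<forall>\<^sub>F a in at_right q. a \<in> {q<..<v i}"
    using True by (intro eventually_at_rightI[of _ "v i"]) auto
  ultimately show ?thesis
  proof eventually_elim
    case (elim a)
    then have "\<lceil>rb i / q\<rceil> - 1 \<le> \<lfloor>rb i / a\<rfloor>" by linarith
    then show ?case using elim assms by (auto simp: dem_def rdem_def min_le_iff_disj nat_mono)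
  qed
qed (simp add: rdem_def)

section \<open>The invariant of the auction\<close>

locale market =
  fixes I :: "'b set" and J :: "'i set" and S :: "'b \<Rightarrow> 'i set" and v b :: "'b \<Rightarrow> real"
  assumes finite_buyers: "finite I" and finite_items: "finite J"
    and preferences: "i \<in> I \<Longrightarrow> S i \<subseteq> J"
    and value_pos: "i \<in> I \<Longrightarrow> 0 < v i"
    and value_le_budget: "i \<in> I \<Longrightarrow> v i \<le> b i"
begin

lemma finite_preferences: "i \<in> I \<Longrightarrow> finite (S i)"
  using preferences finite_items finite_subset by blast

text \<open>All of \<open>I\<close> may serve, because a buyer of zero demand takes no item; this
  avoids a graph that changes with the set of active buyers.\<close>

definition perfect :: "('b \<Rightarrow> nat) \<Rightarrow> 'i set \<Rightarrow> bool" where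
  "perfect c L \<longleftrightarrow> (\<exists>M. bmatching S I c L M \<and> snd ` M = L)"

text \<open>Describes items that may remain in the unsold set without affecting any matching from
  price \<open>p\<close> on.\<close>

definition dead :: "('b \<Rightarrow> real) \<Rightarrow> real \<Rightarrow> 'i set \<Rightarrow> bool" where
  "dead rb p D \<longleftrightarrow> (\<forall>j\<in>D. \<forall>i\<in>I. j \<in> S i \<longrightarrow> (\<forall>x\<ge>p. dem v S rb x i = 0))"

lemma perfect_mono:
  assumes "perfect c L" "L \<subseteq> J" "\<And>i. i \<in> I \<Longrightarrow> c i \<le> c' i"
  shows "perfect c' L"
proof -
  obtain M where M: "bmatching S I c L M" "snd ` M = L" using assms(1) by (auto simp: perfect_def)
  have "bmatching S I c' L M"
  proof (rule bmatching_transfer[OF M(1)])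
    fix i j assume ij: "(i, j) \<in> M"
    then show "i \<in> I \<and> j \<in> L" using bmatching_edge[OF M(1)] by blast
    then show "card {j. (i, j) \<in> M} \<le> c' i"
      using bmatching_degree[OF M(1), of i] assms(3) le_trans by blast
  qed (use finite_buyers finite_subset[OF assms(2) finite_items] in auto)
  then show ?thesis using M by (auto simp: perfect_def)
qed

lemma perfect_le_bsize:
  assumes "perfect c L" "L \<subseteq> Jr" "Jr \<subseteq> J" "B \<subseteq> I" "\<And>i. i \<in> I \<Longrightarrow> 0 < c i \<Longrightarrow> i \<in> B"
  shows "card L \<le> bsize S B c Jr"
proof -
  obtain M where M: "bmatching S I c L M" "snd ` M = L" using assms(1) by (auto simp: perfect_def)
  have finJr: "finite Jr" using finite_subset[OF assms(3) finite_items] .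
  have finL: "finite L" using finite_subset[OF assms(2) finJr] .
  have "bmatching S B c Jr M"
  proof (rule bmatching_transfer[OF M(1) finite_buyers finL subset_refl])
    fix i j assume ij: "(i, j) \<in> M"
    then show "i \<in> B \<and> j \<in> Jr"
      using bmatching_edge[OF M(1) ij] bmatching_degree_pos[OF M(1) finL ij] assms by blast
    show "card {j. (i, j) \<in> M} \<le> c i" by (rule bmatching_degree[OF M(1)])
  qed
  then have "card M \<le> bsize S B c Jr"
    by (rule bmatching_le_bsize[OF finite_subset[OF assms(4) finite_buyers] finJr])
  then show ?thesis using bmatching_card_items[OF M(1) finite_buyers] M(2) by simp
qed

text \<open>No edge can use an item outside \<open>L\<close>, since its buyers have capacity zero. A
  maximum matching with at least \<open>card L\<close> edges thus covers exactly
  \<open>L\<close>.\<close>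

lemma bsize_perfect:
  assumes "card L \<le> bsize S B c Jr" "L \<subseteq> Jr" "Jr \<subseteq> J" "B \<subseteq> I"
    and "\<And>i j. i \<in> B \<Longrightarrow> j \<in> Jr - L \<Longrightarrow> j \<in> S i \<Longrightarrow> c i = 0"
  obtains M where "bmatching S B c L M" "snd ` M = L"
proof -
  have finJr: "finite Jr" using finite_subset[OF assms(3) finite_items] .
  have finL: "finite L" using finite_subset[OF assms(2) finJr] .
  have finB: "finite B" using finite_subset[OF assms(4) finite_buyers] .
  obtain M where M: "bmatching S B c Jr M" "card M = bsize S B c Jr"
    using bsize_attained[OF finB finJr] .
  have inL: "j \<in> L" if "(i, j) \<in> M" for i j
  proof (rule ccontr)
    assume "j \<notin> L"
    then have "c i = 0" using assms(5)[of i j] bmatching_edge[OF M(1) that] by blast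
    then show False using bmatching_degree_pos[OF M(1) finJr that] by simp
  qed
  then have "snd ` M \<subseteq> L" by auto
  moreover have "card L \<le> card (snd ` M)"
    using bmatching_card_items[OF M(1) finB] M(2) assms(1) by simp
  ultimately have "snd ` M = L" using finL by (simp add: card_seteq)
  moreover have "bmatching S B c L M"
    by (rule bmatching_transfer[OF M(1) finB finJr subset_refl])
      (use inL bmatching_edge[OF M(1)] bmatching_degree[OF M(1)] in auto)
  ultimately show ?thesis using that by blast
qed

lemma dem_active: "i \<in> I \<Longrightarrow> 0 < dem v S rb q i \<Longrightarrow> i \<in> Abuyers I S v rb q \<union> Qbuyers I S v rb q"
  by (auto simp: Abuyers_def Qbuyers_def dem_def split: if_splits)

lemma rdem_active: "i \<in> I \<Longrightarrow> 0 < rdem v S rb q i \<Longrightarrow> i \<in> Pbuyers I S v rb q"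
  by (auto simp: Pbuyers_def rdem_def split: if_splits)

lemma buyers_subset:
  "Abuyers I S v rb q \<subseteq> I" "Qbuyers I S v rb q \<subseteq> I" "Pbuyers I S v rb q \<subseteq> I"
  by (auto simp: Abuyers_def Qbuyers_def Pbuyers_def)

text \<open>The size at \<open>q\<close> is at most \<open>card L\<close>, and this many items can
  still be matched immediately after \<open>q\<close>, so there is no drop.\<close>

lemma perfect_not_critical:
  assumes "perfect (rdem v S rb q) L" "L \<subseteq> J"
  shows "\<not> critical I S v L rb q"
proof -
  have finL: "finite L" using finite_subset[OF assms(2) finite_items] .
  let ?B = "Abuyers I S v rb q \<union> Qbuyers I S v rb q"
  have finB: "finite ?B" by (rule finite_subset[OF Un_least[OF buyers_subset(1,2)] finite_buyers])
  obtain M where M: "bmatching S ?B (dem v S rb q) L M" "card M = bsize S ?B (dem v S rb q) L"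
    using bsize_attained[OF finB finL] .
  have "card (snd ` M) \<le> card L"
    by (rule card_mono[OF finL]) (use bmatching_edge[OF M(1)] in auto)
  then have "sizeG I S v L rb q \<le> card L"
    using bmatching_card_items[OF M(1) finB] M(2) by (simp add: sizeG_def)
  also have "card L \<le> sizeGplus I S v L rb q"
    unfolding sizeGplus_def
    by (rule perfect_le_bsize[OF assms(1) subset_refl assms(2)]) (auto simp: rdem_active buyers_subset)
  finally show ?thesis by (simp add: critical_def)
qed

text \<open>The size at \<open>q\<close> is at least \<open>card L\<close> and does not drop
  immediately after \<open>q\<close>; since the items outside \<open>L\<close> are dead, the
  matching after \<open>q\<close> has to cover \<open>L\<close>.\<close>

lemma not_critical_perfect:
  assumes "\<not> critical I S v Jr rb q" "0 < q" "perfect (dem v S rb q) L" "L \<subseteq> Jr" "Jr \<subseteq> J"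
    and "dead rb q (Jr - L)"
  shows "perfect (rdem v S rb q) L"
proof -
  have "card L \<le> sizeG I S v Jr rb q"
    unfolding sizeG_def
    by (rule perfect_le_bsize[OF assms(3,4,5)]) (use dem_active buyers_subset in auto)
  also have "\<dots> \<le> sizeGplus I S v Jr rb q"
    using assms(1,2) by (simp add: critical_def)
  finally have le: "card L \<le> bsize S (Pbuyers I S v rb q) (rdem v S rb q) Jr"
    by (simp add: sizeGplus_def)
  obtain M where M: "bmatching S (Pbuyers I S v rb q) (rdem v S rb q) L M" "snd ` M = L"
  proof (rule bsize_perfect[OF le assms(4,5) buyers_subset(3)])
    fix i j assume "i \<in> Pbuyers I S v rb q" "j \<in> Jr - L" "j \<in> S i"
    then have "dem v S rb q i = 0" using assms(6) by (auto simp: dead_def Pbuyers_def)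
    then show "rdem v S rb q i = 0" using rdem_le_dem[of v S rb q i] by simp
  qed
  have "bmatching S I (rdem v S rb q) L M"
    by (rule bmatching_transfer[OF M(1)])
      (use bmatching_edge[OF M(1)] bmatching_degree[OF M(1)] buyers_subset(3)[of rb q]
        finite_subset[OF _ finite_buyers] finite_subset[OF _ finite_items] assms(4,5) in auto)
  then show ?thesis using M(2) by (auto simp: perfect_def)
qed

lemma dead_later: "dead rb p D \<Longrightarrow> p \<le> q \<Longrightarrow> dead rb q D"
  by (auto simp: dead_def)

text \<open>Between critical prices the maximum matching keeps its size: it can only drop immediately
 after a price, and every such price is critical.\<close>
lemma perfect_advance:
  assumes "perfect (dem v S rb x) L" "0 < x" "x \<le> q" "L \<subseteq> Jr" "Jr \<subseteq> J" "dead rb x (Jr - L)"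
    and noncrit: "\<And>y. x \<le> y \<Longrightarrow> y < q \<Longrightarrow> \<not> critical I S v Jr rb y"
  shows "perfect (dem v S rb q) L"
proof -
  let ?P = "\<lambda>y. perfect (dem v S rb y) L"
  have LJ: "L \<subseteq> J" using assms(4,5) by blast
  \<comment> \<open>Bisection: the implication composes over adjacent intervals, so it suffices to
    prove it on short intervals around each point.\<close>
  have "x \<le> x \<and> q \<le> q \<longrightarrow> ?P x \<longrightarrow> ?P q"
  proof (rule Bolzano[where P = "\<lambda>s t. x \<le> s \<and> t \<le> q \<longrightarrow> ?P s \<longrightarrow> ?P t", OF assms(3)])
    fix s t u :: real
    assume "x \<le> s \<and> t \<le> q \<longrightarrow> ?P s \<longrightarrow> ?P t" "x \<le> t \<and> u \<le> q \<longrightarrow> ?P t \<longrightarrow> ?P u"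
      "s \<le> t" "t \<le> u"
    then show "x \<le> s \<and> u \<le> q \<longrightarrow> ?P s \<longrightarrow> ?P u" by auto
  next
    fix y assume y: "x \<le> y" "y \<le> q"
    then have y0: "0 < y" using assms(2) by simp
    have "\<forall>\<^sub>F a in at_left y. \<forall>i\<in>I. dem v S rb a i \<le> dem v S rb y i"
      by (rule eventually_ball_finite[OF finite_buyers]) (simp add: dem_left_cont[OF y0])
    then obtain c where c: "c < y" "\<And>a i. c < a \<Longrightarrow> a < y \<Longrightarrow> i \<in> I \<Longrightarrow> dem v S rb a i \<le> dem v S rb y i"
      unfolding eventually_at_left[of "y - 1" y, simplified] by blast
    have "\<forall>\<^sub>F a in at_right y. \<forall>i\<in>I. rdem v S rb y i \<le> dem v S rb a i"
      by (rule eventually_ball_finite[OF finite_buyers]) (simp add: rdem_right_limit[OF y0])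
    then obtain d where d: "y < d" "\<And>a i. y < a \<Longrightarrow> a < d \<Longrightarrow> i \<in> I \<Longrightarrow> rdem v S rb y i \<le> dem v S rb a i"
      unfolding eventually_at_right[of y "y + 1", simplified] by blast
    \<comment> \<open>Demands just left of \<open>y\<close> do not exceed those at \<open>y\<close>;
      non-criticality passes from \<open>y\<close> to its right limit; that limit is dominated by
      the demands just right of \<open>y\<close>.\<close>
    have "?P t" if st: "s \<le> y" "y \<le> t" "t - s < min (y - c) (d - y)" "x \<le> s" "t \<le> q" "?P s" for s t
    proof -
      have "?P y"
        by (rule perfect_mono[OF \<open>?P s\<close> LJ]) (use c(2)[of s] st in \<open>cases "s = y"; auto\<close>)
      show ?thesis
      proof (cases "t = y")
        case False
        then have "perfect (rdem v S rb y) L"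
          using not_critical_perfect[OF noncrit y0 \<open>?P y\<close> assms(4,5) dead_later[OF assms(6)]] y st
          by simp
        then show ?thesis
          by (rule perfect_mono[OF _ LJ]) (use d(2)[of t] st False in auto)
      qed (use \<open>?P y\<close> in simp)
    qed
    moreover have "0 < min (y - c) (d - y)" using c d by simp
    ultimately show "\<exists>e>0. \<forall>s t. s \<le> y \<and> y \<le> t \<and> t - s < e \<longrightarrow> (x \<le> s \<and> t \<le> q \<longrightarrow> ?P s \<longrightarrow> ?P t)"
      by blast
  qed
  then show ?thesis using assms(1) by simp
qed

text \<open>\<open>L\<close> is the set of items that still have an active buyer. Each other item \<open>j\<close> carries the
 price \<open>val j\<close> at which it was sold, discarded or lost its last active buyer; an item wanted by
 nobody carries 0.\<close>
definition invar :: "'i set \<Rightarrow> ('i \<Rightarrow> real) \<Rightarrow> real \<Rightarrow> 'i set \<Rightarrow> ('b \<Rightarrow> real) \<Rightarrow> ('b \<Rightarrow> real) \<Rightarrow> bool" where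
  "invar L val p Jr pay rb \<longleftrightarrow>
     L \<subseteq> Jr \<and> Jr \<subseteq> J \<and> dead rb p (Jr - L) \<and>
     (\<forall>i\<in>I. rb i = b i - pay i \<and> 0 \<le> pay i) \<and>
     (\<forall>q\<ge>p. 0 < q \<longrightarrow> (\<exists>x>0. p \<le> x \<and> x \<le> q \<and> perfect (dem v S rb x) L)) \<and>
     (\<forall>j. 0 \<le> val j) \<and>
     (\<forall>i\<in>I. b i / 2 \<le> pay i \<or> (\<forall>j\<in>S i - L. v i \<le> val j)) \<and>
     (\<Sum>j\<in>J - L. val j) \<le> 2 * (\<Sum>i\<in>I. pay i) \<and>
     (\<forall>q\<ge>p. critical I S v Jr rb q \<longrightarrow>
        (\<forall>i\<in>I. v i \<le> q \<or> pay i = 0 \<or> (rb i < q \<and> b i / 2 \<le> pay i)))"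

text \<open>The invariant offers a price \<open>x\<close> in the interval from \<open>p\<close> to
  \<open>q\<close> rather than \<open>p\<close> itself, because at the initial price 0 every demand
  is 0.\<close>

lemma invar_perfect:
  assumes "invar L val p Jr pay rb" "0 < q" "p \<le> q"
    and "\<And>y. p \<le> y \<Longrightarrow> y < q \<Longrightarrow> \<not> critical I S v Jr rb y"
  shows "perfect (dem v S rb q) L"
proof -
  obtain x where x: "0 < x" "p \<le> x" "x \<le> q" "perfect (dem v S rb x) L"
    using assms(1-3) unfolding invar_def by blast
  show ?thesis
    by (rule perfect_advance[OF x(4,1,3), of Jr])
      (use assms(1,4) x dead_later[OF _ x(2)] in \<open>auto simp: invar_def\<close>)
qed

section \<open>Budgets of saturated and of fresh buyers\<close>

text \<open>The demand is the floor of \<open>rb i / q\<close>, so less than the price of one unit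
  remains; at least one unit is bought, so the remainder is at most half.\<close>

lemma saturated_dem:
  assumes "0 < dem v S rb q i" "dem v S rb q i < card (S i)"
  shows "rb i - q * real (dem v S rb q i) < q" "2 * (rb i - q * real (dem v S rb q i)) \<le> rb i"
proof -
  let ?n = "dem v S rb q i"
  have q: "0 < q" and n: "?n = nat \<lfloor>rb i / q\<rfloor>"
    using assms by (auto simp: dem_def split: if_splits)
  then have "real ?n = of_int \<lfloor>rb i / q\<rfloor>" using assms(1) by simp
  then have "rb i / q < real ?n + 1" by linarith
  then show *: "rb i - q * real ?n < q" using q by (simp add: field_simps)
  have "q * 1 \<le> q * real ?n" using q assms(1) by (intro mult_left_mono) auto
  then show "2 * (rb i - q * real ?n) \<le> rb i" using * by simp
qed

text \<open>With the ceiling minus one, a remainder of exactly \<open>q\<close> is possible, hence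
  the weak inequality. Buying one unit still leaves at most half.\<close>

lemma saturated_rdem:
  assumes "0 < rdem v S rb q i" "rdem v S rb q i < card (S i)"
  shows "rb i - q * real (rdem v S rb q i) \<le> q" "2 * (rb i - q * real (rdem v S rb q i)) \<le> rb i"
proof -
  let ?n = "rdem v S rb q i"
  have q: "0 < q" and n: "?n = nat (\<lceil>rb i / q\<rceil> - 1)"
    using assms by (auto simp: rdem_def split: if_splits)
  then have "real ?n = of_int (\<lceil>rb i / q\<rceil> - 1)" using assms(1) by simp
  then have "rb i / q \<le> real ?n + 1" by linarith
  then show *: "rb i - q * real ?n \<le> q" using q by (simp add: field_simps)
  have "q * 1 \<le> q * real ?n" using q assms(1) by (intro mult_left_mono) auto
  then show "2 * (rb i - q * real ?n) \<le> rb i" using * by simp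
qed

text \<open>Here \<open>v i \<le> b i\<close> enters: a price below the value is below the untouched
  budget, so demand stays positive immediately after \<open>q\<close>. The drop is at most one unit,
  so at most half is lost.\<close>

lemma fresh_demand:
  assumes "i \<in> I" "0 < q" "q < v i" "S i \<noteq> {}" "rb i = b i"
  shows "0 < dem v S rb q i" "0 < rdem v S rb q i" "dem v S rb q i \<le> 2 * rdem v S rb q i"
proof -
  have c: "0 < card (S i)" using finite_preferences[OF assms(1)] assms(4) by (simp add: card_gt_0_iff)
  have "1 < rb i / q" using value_le_budget[OF assms(1)] assms by simp
  then have "1 \<le> \<lceil>rb i / q\<rceil> - 1" "\<lfloor>rb i / q\<rfloor> \<le> (\<lceil>rb i / q\<rceil> - 1) + 1" by linarith+
  then have f: "nat \<lfloor>rb i / q\<rfloor> \<le> 2 * nat (\<lceil>rb i / q\<rceil> - 1)" and "0 < nat (\<lceil>rb i / q\<rceil> - 1)" by linarith+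
  with c show "0 < rdem v S rb q i" using assms by (simp add: rdem_def)
  then show "0 < dem v S rb q i" using rdem_le_dem[of v S rb q i] by linarith
  show "dem v S rb q i \<le> 2 * rdem v S rb q i"
    using f assms by (auto simp: rdem_def dem_def min_def)
qed

text \<open>Positive demand means that one unit is affordable, which rules out the alternative
  \<open>rb i < q\<close> in the invariant.\<close>

lemma invar_fresh:
  assumes "invar L val p Jr pay rb" "p \<le> q" "0 < q" "critical I S v Jr rb q"
    and "i \<in> I" "q < v i" "0 < dem v S rb q i"
  shows "pay i = 0" "rb i = b i"
proof -
  have "v i \<le> q \<or> pay i = 0 \<or> rb i < q"
    using assms unfolding invar_def by blast
  moreover have "\<not> rb i < q"
  proof
    assume "rb i < q"
    then have "rb i / q < 1" using assms(3) by simp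
    then have "nat \<lfloor>rb i / q\<rfloor> = 0" by linarith
    then show False using assms(7) by (auto simp: dem_def split: if_splits)
  qed
  ultimately show "pay i = 0" using assms(6) by simp
  then show "rb i = b i" using assms(1,5) by (simp add: invar_def)
qed

section \<open>Preservation of the invariant by the two procedures\<close>

text \<open>The bookkeeping common to both procedures. \<open>count\<close> pays for the prices of
  the newly lost items, \<open>wanted\<close> puts interested buyers at half their budget, and
  \<open>served\<close> with \<open>recritical\<close> keeps served buyers out of later rounds at
  prices below their values.\<close>

lemma invar_step:
  assumes inv: "invar L val p Jr pay rb" and q: "0 < q" "p \<le> q" "critical I S v Jr rb q"
    and sub: "L' \<subseteq> Jr'" "Jr' \<subseteq> Jr" "L' \<subseteq> L"
    and dead': "dead rb' q (Jr' - L')" and perf: "perfect (dem v S rb' q) L'"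
    and count: "card (L - L') \<le> 2 * (\<Sum>i\<in>I. card (G i))"
    and rb': "rb' = (\<lambda>i. rb i - q * real (card (G i)))"
    and served: "\<And>i. \<lbrakk>i \<in> I; q < v i; G i \<noteq> {}\<rbrakk> \<Longrightarrow> rb' i \<le> q \<and> 2 * rb' i \<le> rb i"
    and wanted: "\<And>i j. \<lbrakk>i \<in> I; q < v i; 0 < dem v S rb q i; j \<in> S i; j \<in> L - L'\<rbrakk> \<Longrightarrow> 2 * rb' i \<le> rb i"
    and recritical: "\<And>i. \<lbrakk>critical I S v Jr' rb' q; i \<in> I; q < v i; G i \<noteq> {}\<rbrakk> \<Longrightarrow> rb' i < q"
  shows "invar L' (\<lambda>j. if j \<in> L - L' then q else val j) q Jr' (\<lambda>i. pay i + q * real (card (G i))) rb'"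
proof -
  let ?pay = "\<lambda>i. pay i + q * real (card (G i))"
  let ?val = "\<lambda>j. if j \<in> L - L' then q else val j"
  have LJ: "L \<subseteq> Jr" "Jr \<subseteq> J" and budget: "\<And>i. i \<in> I \<Longrightarrow> rb i = b i - pay i \<and> 0 \<le> pay i"
    and val0: "\<And>j. 0 \<le> val j"
    and account: "\<And>i j. \<lbrakk>i \<in> I; \<not> b i / 2 \<le> pay i; j \<in> S i - L\<rbrakk> \<Longrightarrow> v i \<le> val j"
    and total: "(\<Sum>j\<in>J - L. val j) \<le> 2 * (\<Sum>i\<in>I. pay i)"
    and crit: "\<And>i. i \<in> I \<Longrightarrow> v i \<le> q \<or> pay i = 0 \<or> (rb i < q \<and> b i / 2 \<le> pay i)"
    using inv q unfolding invar_def by blast+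
  have half: "b i / 2 \<le> ?pay i" if "i \<in> I" "2 * rb' i \<le> rb i" for i
    using budget[OF that(1)] that(2) by (simp add: rb' algebra_simps)
  have grow: "pay i \<le> ?pay i" for i using q by simp
  have "b i / 2 \<le> ?pay i \<or> (\<forall>j\<in>S i - L'. v i \<le> ?val j)" if i: "i \<in> I" for i
  proof (rule ccontr)
    assume "\<not> ?thesis"
    then obtain j where j: "\<not> b i / 2 \<le> ?pay i" "j \<in> S i - L'" "\<not> v i \<le> ?val j" by blast
    then have low: "\<not> b i / 2 \<le> pay i" using grow[of i] by linarith
    \<comment> \<open>Items lost earlier are covered by \<open>account\<close>, so \<open>j\<close>
      is lost now and carries the price \<open>q\<close>.\<close>
    then have "j \<in> L - L'" using account[OF i low, of j] j by (auto split: if_splits)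
    then have "q < v i" using j(3) by simp
    \<comment> \<open>At a critical price below her value, a buyer short of half her budget has paid
      nothing. Her demand is then positive, and \<open>wanted\<close> gives the
      contradiction.\<close>
    then have "pay i = 0" using crit[OF i] low by auto
    then have "rb i = b i" using budget[OF i] by simp
    then have "0 < dem v S rb q i" using fresh_demand(1)[OF i q(1) \<open>q < v i\<close>] j by blast
    then show False using wanted[OF i \<open>q < v i\<close>] half[OF i] j \<open>j \<in> L - L'\<close> by blast
  qed
  moreover have "v i \<le> q' \<or> ?pay i = 0 \<or> (rb' i < q' \<and> b i / 2 \<le> ?pay i)"
    if q': "q \<le> q'" "critical I S v Jr' rb' q'" and i: "i \<in> I" for q' i
  proof (cases "q < v i")
    case True
    show ?thesis
    proof (cases "G i = {}")
      case True
      then show ?thesis using crit[OF i] \<open>q < v i\<close> q' by (auto simp: rb')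
    next
      case False
      \<comment> \<open>A remainder of at most \<open>q\<close> is below every later price; at
        \<open>q\<close> itself the strict inequality comes from \<open>recritical\<close>.\<close>
      then have "rb' i < q'" using served[OF i \<open>q < v i\<close>] recritical[OF _ i \<open>q < v i\<close>] q'
        by (cases "q' = q") auto
      then show ?thesis using half[OF i] served[OF i \<open>q < v i\<close> False] by blast
    qed
  qed (use q' in simp)
  moreover have "(\<Sum>j\<in>J - L'. ?val j) \<le> 2 * (\<Sum>i\<in>I. ?pay i)"
  proof -
    have fin: "finite (J - L)" "finite (L - L')"
      using finite_items finite_subset[OF subset_trans[OF LJ] finite_items] by auto
    have "J - L' = (J - L) \<union> (L - L')" using LJ sub by blast
    then have "(\<Sum>j\<in>J - L'. ?val j) = (\<Sum>j\<in>J - L. ?val j) + (\<Sum>j\<in>L - L'. ?val j)"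
      using fin by (simp only:, subst sum.union_disjoint) auto
    also have "\<dots> = (\<Sum>j\<in>J - L. val j) + real (card (L - L')) * q"
      by (intro arg_cong2[where f = "(+)"] sum.cong) auto
    also have "\<dots> \<le> 2 * (\<Sum>i\<in>I. pay i) + real (2 * (\<Sum>i\<in>I. card (G i))) * q"
      using total count q by (intro add_mono mult_right_mono) (auto simp del: of_nat_mult)
    also have "\<dots> = 2 * (\<Sum>i\<in>I. ?pay i)"
      by (simp add: sum.distrib sum_distrib_left[symmetric] algebra_simps)
    finally show ?thesis .
  qed
  moreover have "rb' i = b i - ?pay i \<and> 0 \<le> ?pay i" if "i \<in> I" for i
    using budget[OF that] grow[of i] by (simp add: rb')
  ultimately show ?thesis
    unfolding invar_def using LJ sub dead' perf q(1) val0 by (auto intro: exI[of _ q])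
qed

lemma invar_matched_items:
  assumes "invar L val p Jr pay rb" "p \<le> q" "bmatching S B c Jr M" "B \<subseteq> I"
    and "\<And>i. c i \<le> dem v S rb q i" "(i, j) \<in> M"
  shows "j \<in> L"
proof (rule ccontr)
  assume "j \<notin> L"
  have "finite Jr" using assms(1) finite_items finite_subset unfolding invar_def by blast
  then have "0 < dem v S rb q i"
    using bmatching_degree_pos[OF assms(3) _ assms(6)] assms(5)[of i] by simp
  moreover have "dem v S rb q i = 0"
    using assms(1,2,4) \<open>j \<notin> L\<close> bmatching_edge[OF assms(3,6)]
    unfolding invar_def dead_def by blast
  ultimately show False by simp
qed

lemma dem_cong: "rb' i = rb i \<Longrightarrow> dem v S rb' q i = dem v S rb q i"
  by (simp add: dem_def)

lemma rdem_cong: "rb' i = rb i \<Longrightarrow> rdem v S rb' q i = rdem v S rb q i"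
  by (simp add: rdem_def)

text \<open>Buyers outside \<open>N\<close> keep their capacities, so their part of the matching
  remains valid and covers precisely the items they hold.\<close>

lemma unmatched_rest_perfect:
  assumes "bmatching S B c Jr M" "B \<subseteq> I" "finite Jr"
    and "\<And>i. i \<in> B - N \<Longrightarrow> c' i = c i"
  shows "perfect c' {j. \<exists>i. (i, j) \<in> M \<and> i \<notin> N}"
proof -
  let ?M = "{(i, j) \<in> M. i \<notin> N}"
  have "bmatching S I c' {j. \<exists>i. (i, j) \<in> M \<and> i \<notin> N} ?M"
  proof (rule bmatching_transfer[OF assms(1) finite_subset[OF assms(2) finite_buyers] assms(3)])
    fix i j assume "(i, j) \<in> ?M"
    then have ij: "(i, j) \<in> M" "i \<notin> N" "i \<in> B" using bmatching_edge[OF assms(1)] by auto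
    then show "i \<in> I \<and> j \<in> {j. \<exists>i. (i, j) \<in> M \<and> i \<notin> N}" using assms(2) by blast
    show "card {j. (i, j) \<in> M} \<le> c' i" using bmatching_degree[OF assms(1), of i] assms(4)[of i] ij by simp
  qed blast
  moreover have "snd ` ?M = {j. \<exists>i. (i, j) \<in> M \<and> i \<notin> N}" by force
  ultimately show ?thesis unfolding perfect_def by blast
qed

lemma invar_procI:
  assumes inv: "invar L val p Jr pay rb" and q: "0 < q" "p \<le> q" "critical I S v Jr rb q"
    and noncrit: "\<And>y. p \<le> y \<Longrightarrow> y < q \<Longrightarrow> \<not> critical I S v Jr rb y"
    and M: "max_bmatching S (Abuyers I S v rb q) (dem v S rb q) Jr M"
    and Jbar: "Jbar = Jr - snd ` M"
    and N: "N = nbrs S (Abuyers I S v rb q) Jr M Jbar"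
    and T: "max_bmatching S (Qbuyers I S v rb q) (dem v S rb q) Jbar T"
    and G: "G = (\<lambda>i. {j. (i, j) \<in> M \<and> i \<in> N} \<union> {j. (i, j) \<in> T})"
  shows "\<exists>L' val'. invar L' val' q (Jr - \<Union> (G ` I)) (\<lambda>i. pay i + q * real (card (G i)))
    (\<lambda>i. rb i - q * real (card (G i)))"
proof -
  let ?A = "Abuyers I S v rb q" and ?Q = "Qbuyers I S v rb q" and ?d = "dem v S rb q"
  define rb' where "rb' = (\<lambda>i. rb i - q * real (card (G i)))"
  \<comment> \<open>The items that stay alive are those held by buyers who are not served.\<close>
  define L' where "L' = {j. \<exists>i. (i, j) \<in> M \<and> i \<notin> N}"
  define Sold where "Sold = {j. \<exists>i\<in>N. (i, j) \<in> M}"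
  have LJ: "L \<subseteq> Jr" "Jr \<subseteq> J" using inv by (auto simp: invar_def)
  have finJr: "finite Jr" using LJ finite_items finite_subset by blast
  have finJbar: "finite Jbar" using finJr Jbar by simp
  have AI: "?A \<subseteq> I" and QI: "?Q \<subseteq> I" by (rule buyers_subset)+
  have finA: "finite ?A" and finQ: "finite ?Q" using AI QI finite_buyers finite_subset by blast+
  have NA: "N \<subseteq> ?A" by (auto simp: N nbrs_def)
  have finN: "finite N" using NA finA finite_subset by blast
  have bm: "bmatching S ?A ?d Jr M" using M by (simp add: max_bmatching_def)
  have bt: "bmatching S ?Q ?d Jbar T" using T by (simp add: max_bmatching_def)
  have live: "j \<in> L" if "(i, j) \<in> M" for i j
    by (rule invar_matched_items[OF inv q(2) bm AI _ that]) simp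
  have uniq: "i = k" if "(i, j) \<in> M" "(k, j) \<in> M" for i j k
    using bmatching_unique[OF bm finA that] .
  have AQ: "?A \<inter> ?Q = {}" by (auto simp: Abuyers_def Qbuyers_def)
  have TQ: "i \<in> ?Q \<and> j \<in> Jbar" if "(i, j) \<in> T" for i j using bmatching_edge[OF bt that] by blast
  \<comment> \<open>Every buyer of value above \<open>q\<close> who wants a free or sold item is
    served, hence saturated.\<close>
  have closed: "i \<in> N" if "i \<in> ?A" "j \<in> S i" "j \<in> Jbar \<or> j \<in> Sold" for i j
  proof -
    have jr: "j \<in> Jr" using that(3) bmatching_edge[OF bm] by (auto simp: Jbar Sold_def)
    show ?thesis
      unfolding N using nbrs_closed[OF bm finA that(1,2) jr _ Jbar] that(3) by (auto simp: Sold_def N)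
  qed
  have GA: "G i = {j. (i, j) \<in> M \<and> i \<in> N}" if "i \<notin> ?Q" for i
    using that TQ by (auto simp: G)
  have Gempty: "G i = {}" if "i \<in> ?A - N" for i
    using that GA[of i] AQ by auto
  have GN: "card (G i) = ?d i" "?d i < card (S i)" "0 < ?d i" if i: "i \<in> N" for i
  proof -
    have iA: "i \<in> ?A" using NA i by blast
    have "G i = {j. (i, j) \<in> M}" using GA[of i] i iA AQ by auto
    moreover have sat: "card {j. (i, j) \<in> M} = ?d i"
      by (rule nbrs_saturated[OF finA finJr M]) (use i N Jbar in simp)
    ultimately show "card (G i) = ?d i" by simp
    obtain z where "z \<in> S i" "(i, z) \<notin> M" using nbrs_spare_item[of i] i N by blast
    then show "?d i < card (S i)"
      using degree_less_card[OF bm finite_preferences] iA AI sat by force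
    show "0 < ?d i" using iA by (simp add: Abuyers_def)
  qed
  have satN: "rb' i < q" "2 * rb' i \<le> rb i" if "i \<in> N" for i
    using saturated_dem[OF GN(3,2)[OF that]] GN(1)[OF that] by (simp_all add: rb'_def)
  have lost: "L - L' = (Jbar \<inter> L) \<union> Sold"
  proof -
    have "j \<in> Jbar \<or> j \<in> Sold" if "j \<in> L - L'" for j
    proof (cases "j \<in> snd ` M")
      case True
      then obtain i where "(i, j) \<in> M" by force
      then show ?thesis using that by (auto simp: L'_def Sold_def)
    qed (use that LJ Jbar in blast)
    moreover have "j \<notin> L'" if "j \<in> Jbar" for j using that by (force simp: Jbar L'_def)
    moreover have "j \<notin> L'" if "j \<in> Sold" for j using that uniq by (auto simp: L'_def Sold_def)
    moreover have "Sold \<subseteq> L" using live by (auto simp: Sold_def)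
    ultimately show ?thesis by blast
  qed
  have lost_cases: "j \<in> Jbar \<or> j \<in> Sold \<or> j \<in> L'" if "j \<in> Jr" for j
  proof (cases "j \<in> snd ` M")
    case True
    then obtain i where "(i, j) \<in> M" by force
    then show ?thesis by (auto simp: L'_def Sold_def)
  qed (use that Jbar in blast)
  have soldG: "\<Union> (G ` I) = Sold \<union> snd ` T"
  proof (intro equalityI subsetI)
    fix j assume "j \<in> Sold \<union> snd ` T"
    then show "j \<in> \<Union> (G ` I)"
    proof
      assume "j \<in> snd ` T"
      then obtain i where "(i, j) \<in> T" by force
      then show ?thesis using TQ[of i j] QI by (auto simp: G)
    qed (use NA AI in \<open>auto simp: G Sold_def\<close>)
  qed (force simp: G Sold_def)
  have "invar L' (\<lambda>j. if j \<in> L - L' then q else val j) q (Jr - \<Union> (G ` I))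
      (\<lambda>i. pay i + q * real (card (G i))) rb'"
  proof (rule invar_step[OF inv q])
    show "L' \<subseteq> Jr - \<Union> (G ` I)"
    proof
      fix j assume "j \<in> L'"
      then obtain i where i: "(i, j) \<in> M" "i \<notin> N" by (auto simp: L'_def)
      have "j \<notin> Sold" using uniq i by (auto simp: Sold_def)
      moreover have "j \<notin> snd ` T" using TQ i by (force simp: Jbar)
      ultimately show "j \<in> Jr - \<Union> (G ` I)"
        unfolding soldG using bmatching_edge[OF bm i(1)] by blast
    qed
    show "L' \<subseteq> L" using live by (auto simp: L'_def)
    show "dead rb' q (Jr - \<Union> (G ` I) - L')"
      unfolding dead_def
    proof (intro ballI impI allI)
      fix j i x assume j: "j \<in> Jr - \<Union> (G ` I) - L'" and i: "i \<in> I" "j \<in> S i" and x: "q \<le> x"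
      have jb: "j \<in> Jbar" "j \<notin> snd ` T"
        using j lost_cases unfolding soldG by blast+
      \<comment> \<open>Remaining demand requires a budget of at least \<open>q\<close>. But a buyer
        interested in \<open>j\<close> is saturated by \<open>M\<close> or by \<open>T\<close>, and
        keeps less than \<open>q\<close>.\<close>
      have "dem v S rb' q i = 0"
      proof (rule ccontr)
        assume pos: "dem v S rb' q i \<noteq> 0"
        have le: "rb' i \<le> rb i" using q by (simp add: rb'_def)
        have big: "\<not> rb' i < q"
        proof
          assume "rb' i < q"
          then have "rb' i / q < 1" using q by simp
          then have "nat \<lfloor>rb' i / q\<rfloor> = 0" by linarith
          then show False using pos by (auto simp: dem_def split: if_splits)
        qed
        have "0 < card (S i)" using finite_preferences[OF i(1)] i(2) by (auto simp: card_gt_0_iff)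
        moreover have "1 \<le> rb i / q" using big le q by simp
        then have "1 \<le> \<lfloor>rb i / q\<rfloor>" by linarith
        ultimately have dpos: "0 < ?d i" using pos by (auto simp: dem_def split: if_splits)
        from dem_active[OF i(1) this] show False
        proof
          assume "i \<in> ?A"
          then have "i \<in> N" using closed[OF _ i(2)] jb(1) by simp
          then show False using satN(1) big by simp
        next
          assume iQ: "i \<in> ?Q"
          have notT: "(i, j) \<notin> T" using jb by force
          \<comment> \<open>A single unmatched edge to an item free in \<open>T\<close> is an
            alternating path, so \<open>T\<close> saturates \<open>i\<close>.\<close>
          have "altn S ?Q Jbar T 0 i j" using altn.base iQ jb(1) i(2) notT .
          then have "?d i \<le> card {j. (i, j) \<in> T}"
            by (rule no_augmenting_path[OF finQ finJbar T _ jb(2)])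
          then have "card {j. (i, j) \<in> T} = ?d i" using bmatching_degree[OF bt, of i] by simp
          moreover have "G i = {j. (i, j) \<in> T}" using iQ AQ NA by (auto simp: G)
          moreover have "card {j. (i, j) \<in> T} < card (S i)"
            by (rule degree_less_card[OF bt finite_preferences[OF i(1)] i(2) notT])
          ultimately show False using saturated_dem(1)[OF dpos] big by (simp add: rb'_def)
        qed
      qed
      then show "dem v S rb' x i = 0" by (rule dem_pos_antimono[OF _ q(1) x])
    qed
    show "perfect (dem v S rb' q) L'"
      unfolding L'_def
      by (rule unmatched_rest_perfect[OF bm AI finJr]) (auto intro!: dem_cong simp: rb'_def Gempty)
    show "card (L - L') \<le> 2 * (\<Sum>i\<in>I. card (G i))"
    proof -
      \<comment> \<open>The comparison matching: at price \<open>q\<close> the demands still absorb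
        all of \<open>L\<close>.\<close>
      obtain K where K: "bmatching S I ?d L K" "snd ` K = L"
        using invar_perfect[OF inv q(1,2) noncrit] by (auto simp: perfect_def)
      have finL: "finite L" using finJr LJ finite_subset by blast
      have finT: "finite T" using bmatching_finite[OF bt finQ finJbar] .
      let ?KN = "{j. \<exists>i\<in>N. (i, j) \<in> K}" and ?KT = "{(i, j) \<in> K. i \<in> ?Q \<and> j \<in> Jbar}"
      have finK: "finite K" using bmatching_finite[OF K(1) finite_buyers finL] .
      have "finite ?KN" by (rule finite_subset[OF _ finL]) (use bmatching_edge[OF K(1)] in blast)
      have "finite ?KT" by (rule finite_subset[OF _ finK]) blast
      \<comment> \<open>\<open>K\<close> gives such an item either to a buyer of value
        \<open>q\<close> or, by \<open>closed\<close>, to a buyer in \<open>N\<close>.\<close>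
      have "Jbar \<inter> L \<subseteq> ?KN \<union> snd ` ?KT"
      proof
        fix j assume j: "j \<in> Jbar \<inter> L"
        then obtain i where ij: "(i, j) \<in> K" using K(2) by force
        then have "i \<in> ?A \<union> ?Q" "j \<in> S i"
          using bmatching_edge[OF K(1) ij] dem_active bmatching_degree_pos[OF K(1) finL ij] by blast+
        then show "j \<in> ?KN \<union> snd ` ?KT" using closed[of i j] j ij by force
      qed
      then have "card (Jbar \<inter> L) \<le> card (?KN \<union> snd ` ?KT)"
        by (rule card_mono[rotated]) (use \<open>finite ?KN\<close> \<open>finite ?KT\<close> in blast)
      also have "\<dots> \<le> card ?KN + card (snd ` ?KT)" by (rule card_Un_le)
      also have "card ?KN = (\<Sum>i\<in>N. card {j. (i, j) \<in> K})"
        by (rule card_items_of_buyers[OF K(1) finite_buyers finL finN])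
      \<comment> \<open>\<open>M\<close> gives the buyers in \<open>N\<close> their full demand, and
        \<open>K\<close> cannot give more.\<close>
      also have "\<dots> \<le> (\<Sum>i\<in>N. card {j. (i, j) \<in> M})"
      proof (rule sum_mono)
        fix i assume "i \<in> N"
        then have "card {j. (i, j) \<in> M} = ?d i"
          by (intro nbrs_saturated[OF finA finJr M]) (simp add: N Jbar)
        then show "card {j. (i, j) \<in> K} \<le> card {j. (i, j) \<in> M}"
          using bmatching_degree[OF K(1), of i] by simp
      qed
      also have "\<dots> = card Sold"
        unfolding Sold_def by (rule card_items_of_buyers[OF bm finA finJr finN, symmetric])
      also have "card (snd ` ?KT) \<le> card T"
      proof -
        \<comment> \<open>\<open>?KT\<close> lives in the graph in which \<open>T\<close> is
          maximum.\<close>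
        have "bmatching S ?Q ?d Jbar ?KT"
          by (rule bmatching_transfer[OF K(1) finite_buyers finL])
            (use bmatching_degree[OF K(1)] in auto)
        then have "card ?KT \<le> card T" using T by (simp add: max_bmatching_def)
        then show ?thesis using card_image_le[OF \<open>finite ?KT\<close>, of snd] by linarith
      qed
      also have "card T = card (snd ` T)" by (rule bmatching_card_items[OF bt finQ, symmetric])
      finally have "card (Jbar \<inter> L) \<le> card Sold + card (snd ` T)" by simp
      moreover have "card (L - L') \<le> card (Jbar \<inter> L) + card Sold"
        unfolding lost by (rule card_Un_le)
      moreover have "card Sold + card (snd ` T) = card (\<Union> (G ` I))"
        unfolding soldG
      proof (rule card_Un_disjoint[symmetric])
        show "finite Sold"
          by (rule finite_subset[OF _ finJr]) (use bmatching_edge[OF bm] in \<open>auto simp: Sold_def\<close>)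
        show "finite (snd ` T)" using finT by simp
        show "Sold \<inter> snd ` T = {}" using TQ by (force simp: Sold_def Jbar)
      qed
      moreover have "card (\<Union> (G ` I)) \<le> (\<Sum>i\<in>I. card (G i))"
        by (rule card_UN_le[OF finite_buyers])
      \<comment> \<open>\<open>Sold\<close> enters twice, as lost items and in the bound on
        \<open>Jbar \<inter> L\<close>; this is the factor 2.\<close>
      ultimately show ?thesis by linarith
    qed
    fix i assume i: "i \<in> I" "q < v i"
    have iQ: "i \<notin> ?Q" using i by (auto simp: Qbuyers_def)
    have inN: "i \<in> N" if "G i \<noteq> {}" using GA[OF iQ] that by auto
    show "rb' i \<le> q \<and> 2 * rb' i \<le> rb i" if "G i \<noteq> {}" using satN[OF inN[OF that]] by simp
    show "rb' i < q" if "G i \<noteq> {}" using satN[OF inN[OF that]] by simp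
    show "2 * rb' i \<le> rb i" if "0 < ?d i" "j \<in> S i" "j \<in> L - L'" for j
    proof -
      have "i \<in> ?A" using i that by (simp add: Abuyers_def)
      then have "i \<in> N" using closed[OF _ that(2)] that(3) unfolding lost by blast
      then show ?thesis by (rule satN(2))
    qed
  qed (auto simp: rb'_def)
  then show ?thesis unfolding rb'_def by blast
qed

lemma invar_procII:
  assumes inv: "invar L val p Jr pay rb" and q: "0 < q" "p \<le> q" "critical I S v Jr rb q"
    and noncrit: "\<And>y. p \<le> y \<Longrightarrow> y < q \<Longrightarrow> \<not> critical I S v Jr rb y"
    and size: "\<not> sizeGbar I S v Jr rb q < sizeG I S v Jr rb q"
    and M: "max_bmatching S (Pbuyers I S v rb q) (rdem v S rb q) Jr M"
    and Jbar: "Jbar = Jr - snd ` M"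
    and N: "N = nbrs S (Pbuyers I S v rb q) Jr M Jbar"
    and G: "G = (\<lambda>i. {j. (i, j) \<in> M \<and> i \<in> N})"
    and rb': "rb' = (\<lambda>i. rb i - q * real (card (G i)))"
    and J2: "J2 = {j \<in> Jr - \<Union> (G ` I) - Jbar. \<exists>i\<in>I. j \<in> S i \<and> q < v i \<and> 0 < rdem v S rb' q i}"
  shows "\<exists>L' val'. invar L' val' q J2 (\<lambda>i. pay i + q * real (card (G i))) rb'"
proof -
  let ?P = "Pbuyers I S v rb q" and ?A = "Abuyers I S v rb q"
    and ?d = "dem v S rb q" and ?r = "rdem v S rb q"
  define Sold where "Sold = {j. \<exists>i\<in>N. (i, j) \<in> M}"
  have LJ: "L \<subseteq> Jr" "Jr \<subseteq> J" using inv by (auto simp: invar_def)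
  have finJr: "finite Jr" by (rule finite_subset[OF LJ(2) finite_items])
  have finL: "finite L" by (rule finite_subset[OF LJ(1) finJr])
  have PI: "?P \<subseteq> I" and AI: "?A \<subseteq> I" by (rule buyers_subset)+
  have finP: "finite ?P" by (rule finite_subset[OF PI finite_buyers])
  have finA: "finite ?A" by (rule finite_subset[OF AI finite_buyers])
  have NP: "N \<subseteq> ?P" by (auto simp: N nbrs_def)
  have finN: "finite N" by (rule finite_subset[OF NP finP])
  have bm: "bmatching S ?P ?r Jr M" using M by (simp add: max_bmatching_def)
  have live: "j \<in> L" if "(i, j) \<in> M" for i j
    by (rule invar_matched_items[OF inv q(2) bm PI rdem_le_dem that])
  have uniq: "i = k" if "(i, j) \<in> M" "(k, j) \<in> M" for i j k
    using bmatching_unique[OF bm finP that] .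
  have closed: "i \<in> N" if "i \<in> ?P" "j \<in> S i" "j \<in> Jbar \<or> j \<in> Sold" for i j
  proof -
    have jr: "j \<in> Jr" using that(3) bmatching_edge[OF bm] by (auto simp: Jbar Sold_def)
    show ?thesis
      unfolding N using nbrs_closed[OF bm finP that(1,2) jr _ Jbar] that(3) by (auto simp: Sold_def N)
  qed
  \<comment> \<open>A buyer active at the critical price \<open>q\<close> with value above
    \<open>q\<close> has not paid yet, so \<open>fresh_demand\<close> applies.\<close>
  have active: "i \<in> ?P" "?d i \<le> 2 * ?r i" if "i \<in> I" "q < v i" "0 < ?d i" for i
  proof -
    have "S i \<noteq> {}" using that(3) by (auto simp: dem_def split: if_splits)
    note fresh = fresh_demand[where rb = rb, OF that(1) q(1) that(2) this invar_fresh(2)[OF inv q(2,1,3) that]]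
    show "i \<in> ?P" using fresh(2) that by (simp add: Pbuyers_def)
    show "?d i \<le> 2 * ?r i" by (rule fresh(3))
  qed
  have GN: "card (G i) = ?r i" "?r i < card (S i)" "0 < ?r i" if i: "i \<in> N" for i
  proof -
    have iP: "i \<in> ?P" using NP i by blast
    have sat: "card {j. (i, j) \<in> M} = ?r i"
      by (rule nbrs_saturated[OF finP finJr M]) (use i N Jbar in simp)
    then show "card (G i) = ?r i" using i by (simp add: G)
    obtain z where "z \<in> S i" "(i, z) \<notin> M" using nbrs_spare_item[of i] i N by blast
    then show "?r i < card (S i)"
      using degree_less_card[OF bm finite_preferences] iP PI sat by force
    show "0 < ?r i" using iP by (simp add: Pbuyers_def)
  qed
  have satN: "rb' i \<le> q" "2 * rb' i \<le> rb i" if "i \<in> N" for i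
    using saturated_rdem[OF GN(3,2)[OF that]] GN(1)[OF that] by (simp_all add: rb')
  have soldG: "\<Union> (G ` I) = Sold"
    using NP PI by (auto simp: G Sold_def)
  \<comment> \<open>The final removal of undemanded items takes away none held by an unserved buyer,
    because that buyer keeps her positive right-limit demand.\<close>
  have J2_rest: "J2 = {j. \<exists>i. (i, j) \<in> M \<and> i \<notin> N}"
  proof (intro equalityI subsetI)
    fix j assume "j \<in> J2"
    then have j: "j \<in> snd ` M" "j \<notin> Sold" unfolding J2 soldG by (auto simp: Jbar)
    then obtain i where "(i, j) \<in> M" by force
    then show "j \<in> {j. \<exists>i. (i, j) \<in> M \<and> i \<notin> N}" using j(2) by (auto simp: Sold_def)
  next
    fix j assume "j \<in> {j. \<exists>i. (i, j) \<in> M \<and> i \<notin> N}"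
    then obtain i where ij: "(i, j) \<in> M" "i \<notin> N" by blast
    have "j \<notin> Sold" using uniq ij by (auto simp: Sold_def)
    moreover have "j \<notin> Jbar" using ij by (force simp: Jbar)
    moreover have "rdem v S rb' q i = ?r i" using ij by (intro rdem_cong) (simp add: rb' G)
    ultimately show "j \<in> J2"
      unfolding J2 soldG using bmatching_edge[OF bm ij(1)] by (auto simp: Pbuyers_def)
  qed
  have lost: "L - J2 = (Jbar \<inter> L) \<union> Sold"
  proof -
    have "j \<in> Jbar \<or> j \<in> Sold" if "j \<in> L - J2" for j
    proof (cases "j \<in> snd ` M")
      case True
      then obtain i where "(i, j) \<in> M" by force
      then show ?thesis using that by (auto simp: J2_rest Sold_def)
    qed (use that LJ Jbar in blast)
    moreover have "j \<notin> J2" if "j \<in> Jbar \<or> j \<in> Sold" for j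
      using that unfolding J2 soldG by blast
    moreover have "Sold \<subseteq> L" using live by (auto simp: Sold_def)
    ultimately show ?thesis by blast
  qed
  have perf: "perfect (rdem v S rb' q) J2"
    unfolding J2_rest
    by (rule unmatched_rest_perfect[OF bm PI finJr]) (auto intro!: rdem_cong simp: rb' G)
  have J2L: "J2 \<subseteq> L" using live by (auto simp: J2_rest)
  have J2J: "J2 \<subseteq> J" using J2L LJ by blast
  have "invar J2 (\<lambda>j. if j \<in> L - J2 then q else val j) q J2
      (\<lambda>i. pay i + q * real (card (G i))) rb'"
  proof (rule invar_step[OF inv q])
    show "J2 \<subseteq> Jr" using J2 by blast
    show "J2 \<subseteq> L" by (rule J2L)
    show "dead rb' q (J2 - J2)" by (simp add: dead_def)
    show "perfect (dem v S rb' q) J2"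
      by (rule perfect_mono[OF perf J2J rdem_le_dem])
    show "rb' = (\<lambda>i. rb i - q * real (card (G i)))" by (rule rb')
    show "card (L - J2) \<le> 2 * (\<Sum>i\<in>I. card (G i))"
    proof -
      have "card L \<le> sizeG I S v Jr rb q"
        unfolding sizeG_def
        by (rule perfect_le_bsize[OF invar_perfect[OF inv q(1,2) noncrit] LJ])
          (use dem_active buyers_subset in auto)
      then have le: "card L \<le> bsize S ?A ?d Jr" using size by (simp add: sizeGbar_def)
      \<comment> \<open>Buyers of value exactly \<open>q\<close> do not increase the matching size
        here, so \<open>L\<close> can be covered by buyers of larger value alone.\<close>
      obtain K where K: "bmatching S ?A ?d L K" "snd ` K = L"
      proof (rule bsize_perfect[OF le LJ AI])
        fix i j assume "i \<in> ?A" "j \<in> Jr - L" "j \<in> S i"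
        then show "?d i = 0" using inv q(2) AI unfolding invar_def dead_def by blast
      qed
      let ?KN = "{j. \<exists>i\<in>N. (i, j) \<in> K}"
      \<comment> \<open>The partner of a lost item under \<open>K\<close> stays active after
        \<open>q\<close>, and closedness then puts her in \<open>N\<close>.\<close>
      have "L - J2 \<subseteq> ?KN"
      proof
        fix j assume j: "j \<in> L - J2"
        then obtain i where ij: "(i, j) \<in> K" using K(2) by force
        then have i: "i \<in> ?A" "j \<in> S i" using bmatching_edge[OF K(1) ij] by auto
        then have "i \<in> ?P" using active(1) by (auto simp: Abuyers_def)
        then have "i \<in> N" using closed[OF _ i(2)] j unfolding lost by blast
        then show "j \<in> ?KN" using ij by blast
      qed
      moreover have "finite ?KN"
        by (rule finite_subset[OF _ finL]) (use bmatching_edge[OF K(1)] in auto)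
      ultimately have "card (L - J2) \<le> card ?KN" by (intro card_mono)
      also have "\<dots> = (\<Sum>i\<in>N. card {j. (i, j) \<in> K})"
        by (rule card_items_of_buyers[OF K(1) finA finL finN])
      \<comment> \<open>\<open>K\<close> respects demands at \<open>q\<close>, while sales follow
        demands immediately after \<open>q\<close>, which are at least half as large.\<close>
      also have "\<dots> \<le> (\<Sum>i\<in>N. 2 * card (G i))"
      proof (rule sum_mono)
        fix i assume iN: "i \<in> N"
        have "0 < ?d i" using GN(3)[OF iN] rdem_le_dem[of v S rb q i] by simp
        moreover have "i \<in> I" "q < v i" using iN NP by (auto simp: Pbuyers_def)
        ultimately have "?d i \<le> 2 * ?r i" by (intro active(2))
        then show "card {j. (i, j) \<in> K} \<le> 2 * card (G i)"
          using bmatching_degree[OF K(1), of i] GN(1)[OF iN] by simp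
      qed
      also have "\<dots> \<le> (\<Sum>i\<in>I. 2 * card (G i))"
        by (rule sum_mono2) (use NP PI finite_buyers in auto)
      finally show ?thesis by (simp add: sum_distrib_left)
    qed
    fix i assume i: "i \<in> I" "q < v i"
    have inN: "i \<in> N" if "G i \<noteq> {}" using that by (auto simp: G)
    show "rb' i \<le> q \<and> 2 * rb' i \<le> rb i" if "G i \<noteq> {}" using satN[OF inN[OF that]] by simp
    \<comment> \<open>Vacuous: the remaining items can all be matched immediately after
      \<open>q\<close>, so \<open>q\<close> is no longer critical.\<close>
    show "rb' i < q" if "critical I S v J2 rb' q"
      using that perfect_not_critical[OF perf J2J] by simp
    show "2 * rb' i \<le> rb i" if "0 < ?d i" "j \<in> S i" "j \<in> L - J2" for j
    proof -
      have "i \<in> N" using closed[OF active(1)[OF i that(1)] that(2)] that(3) unfolding lost by blast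
      then show ?thesis by (rule satN(2))
    qed
  qed simp
  then show ?thesis by blast
qed

lemma invar_alg_step:
  assumes "alg_step I S v (p, Jr, X, pay, rb) (p', Jr', X', pay', rb')" "invar L val p Jr pay rb"
  shows "\<exists>L' val'. invar L' val' p' Jr' pay' rb'"
  using assms(1)
proof cases
  case (procI A Qb JQ M Jbar N T G)
  have "0 < p'" using procI by (simp add: critical_def)
  then show ?thesis
    using invar_procI[OF assms(2), of p' M Jbar N T G] procI by simp
next
  case (procII P M Jbar N G J1)
  have "0 < p'" using procII by (simp add: critical_def)
  then show ?thesis
    using invar_procII[OF assms(2), of p' M Jbar N G rb' Jr'] procII by simp
qed

section \<open>Initial state, termination and comparison with the benchmark\<close>

text \<open>At a sufficiently small positive price every buyer demands her whole set, so each wanted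
  item can go to any buyer who wants it.\<close>

lemma invar_init: "invar (\<Union> (S ` I)) (\<lambda>_. 0) 0 J (\<lambda>_. 0) b"
proof -
  let ?L = "\<Union> (S ` I)"
  have "\<exists>x>0. 0 \<le> x \<and> x \<le> q \<and> perfect (dem v S b x) ?L" if q: "0 < q" for q
  proof -
    \<comment> \<open>The price must be at most \<open>q\<close>, each value and what makes the
      whole set affordable; the added 1 keeps the quotient defined when \<open>S i\<close> is
      empty.\<close>
    define x where "x = Min (insert q (v ` I \<union> (\<lambda>i. b i / (1 + real (card (S i)))) ` I))"
    have b0: "0 < b i" if "i \<in> I" for i using value_pos[OF that] value_le_budget[OF that] by simp
    have x: "0 < x" "x \<le> q" and xi: "\<And>i. i \<in> I \<Longrightarrow> x \<le> v i \<and> x \<le> b i / (1 + real (card (S i)))"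
      unfolding x_def using q value_pos b0 finite_buyers by (auto simp: Min_gr_iff)
    have full: "dem v S b x i = card (S i)" if i: "i \<in> I" for i
    proof -
      have "real (card (S i)) * x \<le> b i"
        using xi[OF i] x by (simp add: field_simps)
      then have "real (card (S i)) \<le> b i / x" using x by (simp add: field_simps)
      then have "card (S i) \<le> nat \<lfloor>b i / x\<rfloor>" by (simp add: le_nat_floor)
      then show ?thesis using x xi[OF i] by (simp add: dem_def)
    qed
    obtain f where f: "\<And>j. j \<in> ?L \<Longrightarrow> f j \<in> I \<and> j \<in> S (f j)"
      using bchoice[of ?L "\<lambda>j i. i \<in> I \<and> j \<in> S i"] by blast
    let ?M = "(\<lambda>j. (f j, j)) ` ?L"
    have "bmatching S I (dem v S b x) ?L ?M"
    proof (rule bmatchingI)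
      fix i assume "i \<in> I"
      then show "card {j. (i, j) \<in> ?M} \<le> dem v S b x i"
        unfolding full[OF \<open>i \<in> I\<close>] by (intro card_mono finite_preferences) (use f in auto)
    qed (use f in auto)
    moreover have "snd ` ?M = ?L" by force
    ultimately show ?thesis using x less_imp_le[OF x(1)] unfolding perfect_def by blast
  qed
  then show ?thesis
    unfolding invar_def dead_def using preferences by auto
qed

lemma invar_reachable:
  assumes "(alg_step I S v)\<^sup>*\<^sup>* (alg_init J b) (p, Jr, X, pay, rb)"
  shows "\<exists>L val. invar L val p Jr pay rb"
  using assms
proof (induction "(p, Jr, X, pay, rb)" arbitrary: p Jr X pay rb rule: rtranclp_induct)
  case base
  then show ?case using invar_init by (auto simp: alg_init_def)
next
  case (step s)
  obtain p0 J0 X0 pay0 rb0 where s: "s = (p0, J0, X0, pay0, rb0)" by (cases s)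
  show ?case using step.hyps(3)[OF s] invar_alg_step step.hyps(2) unfolding s by blast
qed

text \<open>Without further critical prices \<open>L\<close> stays matchable up to a price above all
  values, where nobody demands anything.\<close>

lemma invar_terminal:
  assumes inv: "invar L val p Jr pay rb" and final: "alg_terminal I S v (p, Jr, X, pay, rb)"
  shows "L = {}"
proof -
  have noncrit: "\<not> critical I S v Jr rb y" if "p \<le> y" for y
    using final that by (auto simp: alg_terminal_def)
  define q where "q = Max (insert 1 (insert p (v ` I))) + 1"
  have le: "y \<le> q - 1" if "y \<in> insert 1 (insert p (v ` I))" for y
    unfolding q_def using Max_ge[OF _ that] finite_buyers by simp
  have "0 < q" "p \<le> q" and v: "\<And>i. i \<in> I \<Longrightarrow> v i < q"
    using le[of 1] le[of p] le[of "v _"] by fastforce+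
  have "perfect (dem v S rb q) L"
    by (rule invar_perfect[OF inv \<open>0 < q\<close> \<open>p \<le> q\<close> noncrit])
  then obtain M where M: "bmatching S I (dem v S rb q) L M" "snd ` M = L"
    by (auto simp: perfect_def)
  have "finite L" using inv finite_subset[OF _ finite_items] by (auto simp: invar_def)
  then have "(i, j) \<notin> M" for i j
    using bmatching_degree_pos[OF M(1), of i j] bmatching_edge[OF M(1), of i j] v[of i]
    by (auto simp: dem_def)
  then have "M = {}" by auto
  then show ?thesis using M(2) by simp
qed

text \<open>Individual rationality alone bounds the benchmark: a buyer who has spent half her budget
 is charged to her payment, every other buyer to the prices of the items she gets.\<close>
lemma revenue_le:
  assumes inv: "invar {} val p Jr pay rb" and ef: "ef_outcome I J S v b Y P"
  shows "(\<Sum>i\<in>I. P i) \<le> 4 * (\<Sum>i\<in>I. pay i)"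
proof -
  have val0: "\<And>j. 0 \<le> val j" and total: "(\<Sum>j\<in>J. val j) \<le> 2 * (\<Sum>i\<in>I. pay i)"
    and account: "\<And>i. i \<in> I \<Longrightarrow> b i / 2 \<le> pay i \<or> (\<forall>j\<in>S i. v i \<le> val j)"
    and pay0: "\<And>i. i \<in> I \<Longrightarrow> 0 \<le> pay i"
    using inv by (auto simp: invar_def)
  have YJ: "\<And>i. i \<in> I \<Longrightarrow> Y i \<subseteq> J" and disj: "\<And>i k. \<lbrakk>i \<in> I; k \<in> I; i \<noteq> k\<rbrakk> \<Longrightarrow> Y i \<inter> Y k = {}"
    and ir: "\<And>i. i \<in> I \<Longrightarrow> 0 \<le> util S v b i (Y i) (P i)"
    using ef unfolding ef_outcome_def by blast+
  have "P i \<le> 2 * pay i + (\<Sum>j\<in>Y i. val j)" if i: "i \<in> I" for i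
  proof -
    have P: "P i \<le> b i" "P i \<le> v i * real (card (Y i \<inter> S i))"
      using ir[OF i] by (auto simp: util_def split: if_splits)
    have fin: "finite (Y i)" using YJ[OF i] finite_items finite_subset by blast
    have nonneg: "0 \<le> (\<Sum>j\<in>Y i. val j)" by (rule sum_nonneg) (rule val0)
    from account[OF i] show ?thesis
    proof
      assume "b i / 2 \<le> pay i"
      then show ?thesis using P nonneg by linarith
    next
      assume v: "\<forall>j\<in>S i. v i \<le> val j"
      have "P i \<le> (\<Sum>j\<in>Y i \<inter> S i. v i)" using P by (simp add: mult.commute)
      also have "\<dots> \<le> (\<Sum>j\<in>Y i \<inter> S i. val j)" by (rule sum_mono) (use v in blast)
      also have "\<dots> \<le> (\<Sum>j\<in>Y i. val j)" by (rule sum_mono2[OF fin]) (use val0 in auto)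
      finally show ?thesis using pay0[OF i] by linarith
    qed
  qed
  then have "(\<Sum>i\<in>I. P i) \<le> (\<Sum>i\<in>I. 2 * pay i + (\<Sum>j\<in>Y i. val j))" by (rule sum_mono)
  also have "\<dots> = 2 * (\<Sum>i\<in>I. pay i) + (\<Sum>i\<in>I. \<Sum>j\<in>Y i. val j)"
    by (simp add: sum.distrib sum_distrib_left)
  \<comment> \<open>Disjoint bundles charge each item price at most once, so this term adds at most
    another twice the revenue.\<close>
  also have "(\<Sum>i\<in>I. \<Sum>j\<in>Y i. val j) = (\<Sum>j\<in>\<Union> (Y ` I). val j)"
    by (rule sum.UNION_disjoint[symmetric])
      (use disj finite_buyers YJ finite_subset[OF _ finite_items] in auto)
  also have "\<dots> \<le> (\<Sum>j\<in>J. val j)"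
    by (rule sum_mono2[OF finite_items]) (use YJ val0 in auto)
  finally show ?thesis using total by simp
qed

end

theorem theorem2:
  fixes I :: "'b set" and J :: "'i set" and S :: "'b \<Rightarrow> 'i set"
    and v b :: "'b \<Rightarrow> real"
  assumes "finite I" and "finite J"
    and "\<forall>i\<in>I. S i \<subseteq> J"
    and "\<forall>i\<in>I. 0 < v i" and "\<forall>i\<in>I. 0 \<le> b i"
    and "\<forall>i\<in>I. v i \<le> b i"
    and "(alg_step I S v)\<^sup>*\<^sup>* (alg_init J b) (p, Jf, X, pay, rb)"
    and "alg_terminal I S v (p, Jf, X, pay, rb)"
  shows "opt_rev I J S v b / 4 \<le> (\<Sum>i\<in>I. pay i)"
proof -
  interpret market I J S v b
    using assms(1-4,6) by unfold_locales auto
  obtain L val where inv: "invar L val p Jf pay rb"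
    using invar_reachable[OF assms(7)] by blast
  then have "L = {}" by (rule invar_terminal[OF _ assms(8)])
  \<comment> \<open>The empty outcome makes the set under the supremum nonempty, as
    \<open>cSup_least\<close> requires.\<close>
  have "ef_outcome I J S v b (\<lambda>_. {}) (\<lambda>_. 0)"
    using assms(5) by (auto simp: ef_outcome_def util_def)
  then have "{(\<Sum>i\<in>I. P i) |X P. ef_outcome I J S v b X P} \<noteq> {}" by blast
  then have "opt_rev I J S v b \<le> 4 * (\<Sum>i\<in>I. pay i)"
    unfolding opt_rev_def
    by (rule cSup_least) (use revenue_le inv \<open>L = {}\<close> in blast)
  then show ?thesis by simp
qed

end
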